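(* Let $\beta=(\pi_\ell)_{\ell=1}^L$ be any chainable architecture of depth $L\ge 1$, let $\mathbf{A}\in\mathbb{C}^{m\times n}$ with $m=a_1b_1d_1$, $n=a_Lc_Ld_L$, and let $\sigma$ be any permutation of $\{1,\dots,L-1\}$. Let $(\mathbf{X}_\ell)_{\ell=1}^L\in\Sigma^\beta$ be the output of the butterfly algorithm with inputs $(\mathbf{A},\beta,\sigma)$. Then $$\|\mathbf{A}-\mathbf{X}_1\cdots\mathbf{X}_L\|_F\le (\max(L,2)-1)\,E^\beta(\mathbf{A}).$$ If moreover $\sigma$ is the identity permutation $(1,\dots,L-1)$, then $$\|\mathbf{A}-\mathbf{X}_1\cdots\mathbf{X}_L\|_F\le \sqrt{\max(L,2)-1}\,E^\beta(\mathbf{A}).$$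
   Context: A pattern is a tuple $\pi=(a,b,c,d)$ of positive integers; $\mathbf{S}_\pi:=\mathbf{I}_a\otimes\mathbf{1}_{b\times c}\otimes\mathbf{I}_d\in\{0,1\}^{abd\times acd}$ ($\mathbf{I}_k$ identity, $\mathbf{1}_{p\times q}$ all-ones, $\otimes$ Kronecker product). A $\pi$-factor is a complex matrix of size $abd\times acd$ whose support is contained in that of $\mathbf{S}_\pi$; $\Sigma^\pi$ is the set of $\pi$-factors. Patterns $\pi_1=(a_1,b_1,c_1,d_1)$, $\pi_2=(a_2,b_2,c_2,d_2)$ are chainable if $a_1c_1/a_2=b_2d_2/d_1$, this common value $r(\pi_1,\pi_2)$ is an integer, $a_1\mid a_2$ and $d_2\mid d_1$; then $\pi_1*\pi_2:=(a_1,\,b_1d_1/d_2,\,a_2c_2/a_1,\,d_2)$. A chainable pair is redundant if $r(\pi_1,\pi_2)\ge\min(b_1,c_2)$. An architecture $\beta=(\pi_\ell)_{\ell=1}^L$, $\pi_\ell=(a_\ell,b_\ell,c_\ell,d_\ell)$, is a sequence of patterns with $a_\ell c_\ell d_\ell=a_{\ell+1}b_{\ell+1}d_{\ell+1}$; it is chainable if every consecutive pair is chainable (depth $1$ is chainable by convention), and a chainable architecture is redundant if some consecutive pair is redundant (depth $1$ is non-redundant). For chainable $\beta$ and $p\le q$, $\pi_{[p,q]}:=\pi_p*\cdots*\pi_q$ (iterated product; all intermediate pairs are chainable). $\Sigma^\beta:=\Sigma^{\pi_1}\times\cdots\times\Sigma^{\pi_L}$ and $E^\beta(\mathbf{A}):=\inf_{(\mathbf{X}_\ell)\in\Sigma^\beta}\|\mathbf{A}-\mathbf{X}_1\cdots\mathbf{X}_L\|_F$.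 Equivalence classes: for binary $\mathbf{L}\in\{0,1\}^{m\times r},\mathbf{R}\in\{0,1\}^{r\times n}$ let $\mathbf{U}_i:=\mathbf{L}[:,i]\mathbf{R}[i,:]$; define $i\sim j$ iff $\mathbf{U}_i=\mathbf{U}_j$, let $\mathcal{P}(\mathbf{L},\mathbf{R})$ be the resulting partition of $\{1,\dots,r\}$, and for a class $P$ let $R_P\times C_P$ be the support of the common $\mathbf{U}_i$, $i\in P$. TwoFactor$(\mathbf{M},\pi,\pi')$ for chainable $(\pi,\pi')$: start from zero matrices $\mathbf{X},\mathbf{Y}$ of the sizes of $\pi$- and $\pi'$-factors; for each $P\in\mathcal{P}(\mathbf{S}_\pi,\mathbf{S}_{\pi'})$ set $(\mathbf{X}[R_P,P],\mathbf{Y}[P,C_P])$ to any pair $(\mathbf{H},\mathbf{K})\in\mathbb{C}^{|R_P|\times|P|}\times\mathbb{C}^{|P|\times|C_P|}$ minimizing $\|\mathbf{M}[R_P,C_P]-\mathbf{H}\mathbf{K}\|_F$; return $(\mathbf{X},\mathbf{Y})$. Ortho$(\pi,\pi',\mathbf{X},\mathbf{Y},u)$ for a chainable non-redundant pair, $\mathbf{X}\in\Sigma^\pi,\mathbf{Y}\in\Sigma^{\pi'}$: start from zero $\tilde{\mathbf{X}},\tilde{\mathbf{Y}}$; for each $P\in\mathcal{P}(\mathbf{S}_\pi,\mathbf{S}_{\pi'})$: if $u=$ column, take a QR decomposition $\mathbf{X}[R_P,P]=\mathbf{Q}\mathbf{R}$ ($\mathbf{Q}$ with orthonormal columns) and set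 $\tilde{\mathbf{X}}[R_P,P]=\mathbf{Q}$, $\tilde{\mathbf{Y}}[P,C_P]=\mathbf{R}\mathbf{Y}[P,C_P]$; if $u=$ row, take $\mathbf{Y}[P,C_P]^\top=\mathbf{Q}\mathbf{R}$ and set $\tilde{\mathbf{X}}[R_P,P]=\mathbf{X}[R_P,P]\mathbf{R}^\top$, $\tilde{\mathbf{Y}}[P,C_P]=\mathbf{Q}^\top$. Return $(\tilde{\mathbf{X}},\tilde{\mathbf{Y}})$. Butterfly algorithm for non-redundant chainable $\beta$: if $L=1$ return $\mathbf{A}\odot\mathbf{S}_{\pi_1}$ (Hadamard product). Otherwise maintain an ordered list of consecutive intervals $I_1,\dots,I_J$ partitioning $\{1,\dots,L\}$ with factors $\mathbf{X}_{I_k}$; initially $J=1$, $I_1=[1,L]$, $\mathbf{X}_{I_1}=\mathbf{A}$. For $J=1,\dots,L-1$: let $s=\sigma_J$ and $j$ with $s\in I_j=[q,t]$; for $k=1,\dots,j-1$ replace $(\mathbf{X}_{I_k},\mathbf{X}_{I_{k+1}})$ by Ortho$(\pi_{I_k},\pi_{I_{k+1}},\mathbf{X}_{I_k},\mathbf{X}_{I_{k+1}},\text{column})$; for $k=J,J-1,\dots,j+1$ replace $(\mathbf{X}_{I_{k-1}},\mathbf{X}_{I_k})$ by Ortho$(\pi_{I_{k-1}},\pi_{I_k},\mathbf{X}_{I_{k-1}},\mathbf{X}_{I_k},\text{row})$; then compute $(\mathbf{X}_{[q,s]},\mathbf{X}_{[s+1,t]})=$ TwoFactor$(\mathbf{X}_{I_j},\pi_{[q,s]},\pi_{[s+1,t]})$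 and replace $I_j$ by $[q,s],[s+1,t]$ in the list. Output $(\mathbf{X}_{[\ell,\ell]})_{\ell=1}^L$. For a redundant chainable $\beta$: repeatedly replace some redundant consecutive pair $(\pi'_\ell,\pi'_{\ell+1})$ by the single pattern $\pi'_\ell*\pi'_{\ell+1}$ until a non-redundant architecture $\beta'$ is reached, run the algorithm on $(\mathbf{A},\beta',\sigma')$ (with a permutation $\sigma'$ of $\{1,\dots,|\beta'|-1\}$), and output any $(\mathbf{X}_\ell)_{\ell=1}^L\in\Sigma^\beta$ whose product equals the product of the factors obtained for $\beta'$. *)

theory Defs
  imports Complex_Main
begin

section \<open>Matrices as functions with explicit dimensions (0-based indices)\<close>

type_synonym cmat = "nat \<Rightarrow> nat \<Rightarrow> complex"

definition mmul :: "nat \<Rightarrow> cmat \<Rightarrow> cmat \<Rightarrow> cmat" where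
  "mmul k X Y = (\<lambda>i j. \<Sum>t<k. X i t * Y t j)"

definition fnorm :: "nat \<Rightarrow> nat \<Rightarrow> cmat \<Rightarrow> real" where
  "fnorm m n M = sqrt (\<Sum>i<m. \<Sum>j<n. (cmod (M i j))\<^sup>2)"

type_synonym pattern = "nat \<times> nat \<times> nat \<times> nat"

fun pa :: "pattern \<Rightarrow> nat" where "pa (a,b,c,d) = a"
fun pb :: "pattern \<Rightarrow> nat" where "pb (a,b,c,d) = b"
fun pc :: "pattern \<Rightarrow> nat" where "pc (a,b,c,d) = c"
fun pd :: "pattern \<Rightarrow> nat" where "pd (a,b,c,d) = d"

definition valid_pattern :: "pattern \<Rightarrow> bool" where
  "valid_pattern \<pi> \<longleftrightarrow> 0 < pa \<pi> \<and> 0 < pb \<pi> \<and> 0 < pc \<pi> \<and> 0 < pd \<pi>"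

definition prow :: "pattern \<Rightarrow> nat" where "prow \<pi> = pa \<pi> * pb \<pi> * pd \<pi>"
definition pcol :: "pattern \<Rightarrow> nat" where "pcol \<pi> = pa \<pi> * pc \<pi> * pd \<pi>"

text \<open>Support of S_pi = I_a (x) 1_{b x c} (x) I_d: row i = (i1*b+i2)*d+i3, column
  j = (j1*c+j2)*d+j3, entry 1 iff i1 = j1 and i3 = j3.\<close>
definition supp :: "pattern \<Rightarrow> nat \<Rightarrow> nat \<Rightarrow> bool" where
  "supp \<pi> i j \<longleftrightarrow> i < prow \<pi> \<and> j < pcol \<pi> \<and>
     i div (pb \<pi> * pd \<pi>) = j div (pc \<pi> * pd \<pi>) \<and> i mod pd \<pi> = j mod pd \<pi>"

definition Smat :: "pattern \<Rightarrow> nat \<Rightarrow> nat \<Rightarrow> nat" where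
  "Smat \<pi> i j = (if supp \<pi> i j then 1 else 0)"

definition is_factor :: "pattern \<Rightarrow> cmat \<Rightarrow> bool" where
  "is_factor \<pi> X \<longleftrightarrow> (\<forall>i j. X i j \<noteq> 0 \<longrightarrow> supp \<pi> i j)"

definition chainable :: "pattern \<Rightarrow> pattern \<Rightarrow> bool" where
  "chainable \<pi>1 \<pi>2 \<longleftrightarrow>
     real (pa \<pi>1 * pc \<pi>1) / real (pa \<pi>2) = real (pb \<pi>2 * pd \<pi>2) / real (pd \<pi>1) \<and>
     pa \<pi>2 dvd pa \<pi>1 * pc \<pi>1 \<and> pa \<pi>1 dvd pa \<pi>2 \<and> pd \<pi>2 dvd pd \<pi>1"

definition rval :: "pattern \<Rightarrow> pattern \<Rightarrow> nat" where
  "rval \<pi>1 \<pi>2 = pa \<pi>1 * pc \<pi>1 div pa \<pi>2"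

definition pstar :: "pattern \<Rightarrow> pattern \<Rightarrow> pattern" where
  "pstar \<pi>1 \<pi>2 = (pa \<pi>1, pb \<pi>1 * pd \<pi>1 div pd \<pi>2, pa \<pi>2 * pc \<pi>2 div pa \<pi>1, pd \<pi>2)"

definition redundant_pair :: "pattern \<Rightarrow> pattern \<Rightarrow> bool" where
  "redundant_pair \<pi>1 \<pi>2 \<longleftrightarrow> chainable \<pi>1 \<pi>2 \<and> rval \<pi>1 \<pi>2 \<ge> min (pb \<pi>1) (pc \<pi>2)"

definition is_arch :: "(nat \<Rightarrow> pattern) \<Rightarrow> nat \<Rightarrow> bool" where
  "is_arch \<beta> L \<longleftrightarrow> 1 \<le> L \<and> (\<forall>l\<in>{1..L}. valid_pattern (\<beta> l)) \<and>
     (\<forall>l\<in>{1..<L}. pa (\<beta> l) * pc (\<beta> l) * pd (\<beta> l) =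
                    pa (\<beta> (Suc l)) * pb (\<beta> (Suc l)) * pd (\<beta> (Suc l)))"

definition chainable_arch :: "(nat \<Rightarrow> pattern) \<Rightarrow> nat \<Rightarrow> bool" where
  "chainable_arch \<beta> L \<longleftrightarrow> (\<forall>l\<in>{1..<L}. chainable (\<beta> l) (\<beta> (Suc l)))"

definition redundant_arch :: "(nat \<Rightarrow> pattern) \<Rightarrow> nat \<Rightarrow> bool" where
  "redundant_arch \<beta> L \<longleftrightarrow> (\<exists>l\<in>{1..<L}. redundant_pair (\<beta> l) (\<beta> (Suc l)))"

definition patI :: "(nat \<Rightarrow> pattern) \<Rightarrow> nat \<Rightarrow> nat \<Rightarrow> pattern" where
  "patI \<beta> p q = foldl pstar (\<beta> p) (map \<beta> [Suc p..<Suc q])"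

fun pI :: "(nat \<Rightarrow> pattern) \<Rightarrow> nat \<times> nat \<Rightarrow> pattern" where
  "pI \<beta> (q, t) = patI \<beta> q t"

definition factors :: "(nat \<Rightarrow> pattern) \<Rightarrow> nat \<Rightarrow> (nat \<Rightarrow> cmat) set" where
  "factors \<beta> L = {Xs. \<forall>l\<in>{1..L}. is_factor (\<beta> l) (Xs l)}"

fun prodk :: "(nat \<Rightarrow> pattern) \<Rightarrow> (nat \<Rightarrow> cmat) \<Rightarrow> nat \<Rightarrow> cmat" where
  "prodk \<beta> Xs 0 = (\<lambda>i j. if i = j then 1 else 0)"
| "prodk \<beta> Xs (Suc 0) = Xs 1"
| "prodk \<beta> Xs (Suc (Suc k)) = mmul (pcol (\<beta> (Suc k))) (prodk \<beta> Xs (Suc k)) (Xs (Suc (Suc k)))"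

definition Ebeta :: "(nat \<Rightarrow> pattern) \<Rightarrow> nat \<Rightarrow> cmat \<Rightarrow> real" where
  "Ebeta \<beta> L A = Inf {fnorm (prow (\<beta> 1)) (pcol (\<beta> L)) (\<lambda>i j. A i j - prodk \<beta> Xs L i j)
                       | Xs. Xs \<in> factors \<beta> L}"

definition Urank1 :: "pattern \<Rightarrow> pattern \<Rightarrow> nat \<Rightarrow> nat \<Rightarrow> nat \<Rightarrow> nat" where
  "Urank1 \<pi> \<pi>' i = (\<lambda>x y. Smat \<pi> x i * Smat \<pi>' i y)"

definition classes :: "pattern \<Rightarrow> pattern \<Rightarrow> nat set set" where
  "classes \<pi> \<pi>' = {{j. j < pcol \<pi> \<and> Urank1 \<pi> \<pi>' j = Urank1 \<pi> \<pi>' i} | i. i < pcol \<pi>}"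

definition rowsP :: "pattern \<Rightarrow> pattern \<Rightarrow> nat set \<Rightarrow> nat set" where
  "rowsP \<pi> \<pi>' P = {x. \<exists>i\<in>P. \<exists>y. Urank1 \<pi> \<pi>' i x y \<noteq> 0}"

definition colsP :: "pattern \<Rightarrow> pattern \<Rightarrow> nat set \<Rightarrow> nat set" where
  "colsP \<pi> \<pi>' P = {y. \<exists>i\<in>P. \<exists>x. Urank1 \<pi> \<pi>' i x y \<noteq> 0}"

definition block_supported :: "pattern \<Rightarrow> pattern \<Rightarrow> cmat \<Rightarrow> cmat \<Rightarrow> bool" where
  "block_supported \<pi> \<pi>' X Y \<longleftrightarrow>
     (\<forall>x k. X x k \<noteq> 0 \<longrightarrow> (\<exists>P\<in>classes \<pi> \<pi>'. x \<in> rowsP \<pi> \<pi>' P \<and> k \<in> P)) \<and>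
     (\<forall>k y. Y k y \<noteq> 0 \<longrightarrow> (\<exists>P\<in>classes \<pi> \<pi>'. k \<in> P \<and> y \<in> colsP \<pi> \<pi>' P))"

definition blockerr :: "pattern \<Rightarrow> pattern \<Rightarrow> nat set \<Rightarrow> cmat \<Rightarrow> cmat \<Rightarrow> cmat \<Rightarrow> real" where
  "blockerr \<pi> \<pi>' P M H K =
     sqrt (\<Sum>x\<in>rowsP \<pi> \<pi>' P. \<Sum>y\<in>colsP \<pi> \<pi>' P. (cmod (M x y - (\<Sum>k\<in>P. H x k * K k y)))\<^sup>2)"

text \<open>(X, Y) is a possible output of TwoFactor(M, pi, pi').\<close>
definition twofactor :: "cmat \<Rightarrow> pattern \<Rightarrow> pattern \<Rightarrow> cmat \<Rightarrow> cmat \<Rightarrow> bool" where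
  "twofactor M \<pi> \<pi>' X Y \<longleftrightarrow> block_supported \<pi> \<pi>' X Y \<and>
     (\<forall>P\<in>classes \<pi> \<pi>'. \<forall>H K. blockerr \<pi> \<pi>' P M X Y \<le> blockerr \<pi> \<pi>' P M H K)"

datatype orient = Column | Row

definition orthonormal_cols :: "nat set \<Rightarrow> nat set \<Rightarrow> cmat \<Rightarrow> bool" where
  "orthonormal_cols Rs P Q \<longleftrightarrow>
     (\<forall>k\<in>P. \<forall>l\<in>P. (\<Sum>x\<in>Rs. cnj (Q x k) * Q x l) = (if k = l then 1 else 0))"

definition upper_tri :: "nat set \<Rightarrow> cmat \<Rightarrow> bool" where
  "upper_tri P R \<longleftrightarrow> (\<forall>k\<in>P. \<forall>l\<in>P. l < k \<longrightarrow> R k l = 0)"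

text \<open>(X', Y') is a possible output of Ortho(pi, pi', X, Y, u) (QR decompositions,
  with P ordered by the natural order of indices).\<close>
definition ortho :: "orient \<Rightarrow> pattern \<Rightarrow> pattern \<Rightarrow> cmat \<Rightarrow> cmat \<Rightarrow> cmat \<Rightarrow> cmat \<Rightarrow> bool" where
  "ortho u \<pi> \<pi>' X Y X' Y' \<longleftrightarrow> block_supported \<pi> \<pi>' X' Y' \<and>
     (\<forall>P\<in>classes \<pi> \<pi>'. (let Rs = rowsP \<pi> \<pi>' P; Cs = colsP \<pi> \<pi>' P in
       (case u of
          Column \<Rightarrow> (\<exists>Q R. orthonormal_cols Rs P Q \<and> upper_tri P R \<and>
              (\<forall>x\<in>Rs. \<forall>k\<in>P. X x k = (\<Sum>l\<in>P. Q x l * R l k)) \<and>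
              (\<forall>x\<in>Rs. \<forall>k\<in>P. X' x k = Q x k) \<and>
              (\<forall>k\<in>P. \<forall>y\<in>Cs. Y' k y = (\<Sum>l\<in>P. R k l * Y l y)))
        | Row \<Rightarrow> (\<exists>Q R. orthonormal_cols Cs P Q \<and> upper_tri P R \<and>
              (\<forall>y\<in>Cs. \<forall>k\<in>P. Y k y = (\<Sum>l\<in>P. Q y l * R l k)) \<and>
              (\<forall>x\<in>Rs. \<forall>k\<in>P. X' x k = (\<Sum>l\<in>P. X x l * R k l)) \<and>
              (\<forall>k\<in>P. \<forall>y\<in>Cs. Y' k y = Q y k)))))"

section \<open>The butterfly algorithm (as a relation: all possible outputs)\<close>

text \<open>State: list of (interval [q,t], factor X_[q,t]), positions 0-based.\<close>
type_synonym bstate = "((nat \<times> nat) \<times> cmat) list"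

inductive colsweep :: "(nat \<Rightarrow> pattern) \<Rightarrow> nat \<Rightarrow> nat \<Rightarrow> bstate \<Rightarrow> bstate \<Rightarrow> bool"
  for \<beta> where
  "\<not> k < j \<Longrightarrow> colsweep \<beta> k j xs xs"
| "k < j \<Longrightarrow> Suc k < length xs \<Longrightarrow>
   ortho Column (pI \<beta> (fst (xs!k))) (pI \<beta> (fst (xs!Suc k))) (snd (xs!k)) (snd (xs!Suc k)) X' Y' \<Longrightarrow>
   colsweep \<beta> (Suc k) j (xs[k := (fst (xs!k), X'), Suc k := (fst (xs!Suc k), Y')]) ys \<Longrightarrow>
   colsweep \<beta> k j xs ys"

inductive rowsweep :: "(nat \<Rightarrow> pattern) \<Rightarrow> nat \<Rightarrow> nat \<Rightarrow> bstate \<Rightarrow> bstate \<Rightarrow> bool"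
  for \<beta> where
  "\<not> j < k \<Longrightarrow> rowsweep \<beta> k j xs xs"
| "j < k \<Longrightarrow> k < length xs \<Longrightarrow>
   ortho Row (pI \<beta> (fst (xs!(k-1)))) (pI \<beta> (fst (xs!k))) (snd (xs!(k-1))) (snd (xs!k)) X' Y' \<Longrightarrow>
   rowsweep \<beta> (k-1) j (xs[k-1 := (fst (xs!(k-1)), X'), k := (fst (xs!k), Y')]) ys \<Longrightarrow>
   rowsweep \<beta> k j xs ys"

definition bf_step :: "(nat \<Rightarrow> pattern) \<Rightarrow> nat \<Rightarrow> bstate \<Rightarrow> bstate \<Rightarrow> bool" where
  "bf_step \<beta> s xs ys \<longleftrightarrow> (\<exists>j q t xs1 xs2 X Y. j < length xs \<and> fst (xs!j) = (q, t) \<and>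
      q \<le> s \<and> s \<le> t \<and>
      colsweep \<beta> 0 j xs xs1 \<and> rowsweep \<beta> (length xs - 1) j xs1 xs2 \<and>
      twofactor (snd (xs2!j)) (patI \<beta> q s) (patI \<beta> (Suc s) t) X Y \<and>
      ys = take j xs2 @ [((q, s), X), ((Suc s, t), Y)] @ drop (Suc j) xs2)"

inductive bf_iter :: "(nat \<Rightarrow> pattern) \<Rightarrow> (nat \<Rightarrow> nat) \<Rightarrow> nat \<Rightarrow> nat \<Rightarrow> bstate \<Rightarrow> bstate \<Rightarrow> bool"
  for \<beta> \<sigma> L where
  "\<not> J < L \<Longrightarrow> bf_iter \<beta> \<sigma> L J xs xs"
| "J < L \<Longrightarrow> bf_step \<beta> (\<sigma> J) xs ys \<Longrightarrow> bf_iter \<beta> \<sigma> L (Suc J) ys zs \<Longrightarrow> bf_iter \<beta> \<sigma> L J xs zs"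

definition butterfly_nonred :: "(nat \<Rightarrow> pattern) \<Rightarrow> nat \<Rightarrow> (nat \<Rightarrow> nat) \<Rightarrow> cmat \<Rightarrow> (nat \<Rightarrow> cmat) \<Rightarrow> bool" where
  "butterfly_nonred \<beta> L \<sigma> A Xs \<longleftrightarrow>
     (if L = 1 then Xs 1 = (\<lambda>i j. A i j * of_nat (Smat (\<beta> 1) i j))
      else (\<exists>ys. bf_iter \<beta> \<sigma> L 1 [((1, L), A)] ys \<and> length ys = L \<and>
                 (\<forall>l\<in>{1..L}. ys ! (l - 1) = ((l, l), Xs l))))"

definition merge_step :: "(nat \<Rightarrow> pattern) \<times> nat \<Rightarrow> (nat \<Rightarrow> pattern) \<times> nat \<Rightarrow> bool" where
  "merge_step B B' \<longleftrightarrow> (\<exists>l. 1 \<le> l \<and> l < snd B \<and> redundant_pair (fst B l) (fst B (Suc l)) \<and>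
      snd B' = snd B - 1 \<and>
      fst B' = (\<lambda>k. if k < l then fst B k else if k = l then pstar (fst B l) (fst B (Suc l))
                    else fst B (Suc k)))"

definition butterfly :: "(nat \<Rightarrow> pattern) \<Rightarrow> nat \<Rightarrow> (nat \<Rightarrow> nat) \<Rightarrow> cmat \<Rightarrow> (nat \<Rightarrow> cmat) \<Rightarrow> bool" where
  "butterfly \<beta> L \<sigma> A Xs \<longleftrightarrow>
     (if \<not> redundant_arch \<beta> L then butterfly_nonred \<beta> L \<sigma> A Xs
      else (\<exists>\<beta>' L' \<sigma>' Ys. merge_step\<^sup>*\<^sup>* (\<beta>, L) (\<beta>', L') \<and> \<not> redundant_arch \<beta>' L' \<and>
              bij_betw \<sigma>' {1..<L'} {1..<L'} \<and>
              ((\<forall>J\<in>{1..<L}. \<sigma> J = J) \<longrightarrow> (\<forall>J\<in>{1..<L'}. \<sigma>' J = J)) \<and>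
              butterfly_nonred \<beta>' L' \<sigma>' A Ys \<and>
              Xs \<in> factors \<beta> L \<and> prodk \<beta> Xs L = prodk \<beta>' Ys L'))"

end

theory Submission
  imports Defs "HOL-Analysis.L2_Norm"
begin

text \<open>
  For a cut \<open>s\<close> let \<open>C\<^sub>s\<close> be the set of products of a \<open>\<pi>\<^bsub>[1,s]\<^esub>\<close>-factor and a
  \<open>\<pi>\<^bsub>[s+1,L]\<^esub>\<close>-factor; every product of \<open>\<beta>\<close>-factors lies in all the \<open>C\<^sub>s\<close>. Multiplication by
  the orthonormalised factors is isometric, so splitting the current interval at \<open>s = \<sigma>\<^sub>J\<close> replaces the
  current product \<open>B\<^sub>J\<close> by a best approximation \<open>B\<^sub>J\<^sub>+\<^sub>1\<close> of it in \<open>C\<^sub>s\<close>. Such a best approximation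
  arises from \<open>B\<^sub>J\<close> by orthogonally projecting its columns (equally, its rows) block by block. The
  column projections preserve \<open>C\<^sub>s\<^sub>'\<close> for \<open>s' > s\<close> and the row projections preserve it for \<open>s' < s\<close>,
  so the distance to no \<open>C\<^sub>s\<^sub>'\<close> increases along the iteration. Hence each of the \<open>L - 1\<close> steps costs at
  most the distance from \<open>A\<close> to the products of \<open>\<beta>\<close>-factors, and the triangle inequality gives the
  first bound. If the cuts are made from left to right, the step errors are mutually orthogonal, which
  gives the square root.
  Merging a redundant pair enlarges the set of attainable products and shortens the architecture.
\<close>

section \<open>Orthogonal projections\<close>

text \<open>The projections are controlled only one cut at a time, so no single product of
  \<open>\<beta>\<close>-factors can serve as the competitor throughout. The induction keeps a
  separate competitor for every cut; a column projection replaces only its left factor, a row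
  projection only its right factor. Which of the two respects the supports is arithmetic. The
  pattern of an interval \<open>[p,q]\<close> links a row and a column iff they have the same block
  number among \<open>a p\<close> equal consecutive blocks and the same residue modulo
  \<open>d q\<close>. As \<open>a\<close> grows and \<open>d\<close> shrinks by divisibility along
  the architecture, block numbers get coarser when \<open>p\<close> decreases and residues get
  coarser when \<open>q\<close> increases. The same arithmetic makes blockwise QR sufficient: two
  columns that the factors further right can combine either lie in one class, hence are orthonormal,
  or have disjoint supports. The constant \<open>max L 2 - 1\<close> counts the cuts. At depth one
  there is no cut; masking \<open>A\<close> by the support is then already optimal, which accounts
  for the value 1.\<close>

definition ip :: "'a set \<Rightarrow> ('a \<Rightarrow> complex) \<Rightarrow> ('a \<Rightarrow> complex) \<Rightarrow> complex" where
  "ip S u v = (\<Sum>i\<in>S. cnj (u i) * v i)"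

definition sq :: "'a set \<Rightarrow> ('a \<Rightarrow> complex) \<Rightarrow> real" where
  "sq S v = (\<Sum>i\<in>S. (cmod (v i))\<^sup>2)"

lemma sq_nonneg: "0 \<le> sq S v"
  by (simp add: sq_def sum_nonneg)

lemma of_real_sq: "complex_of_real (sq S v) = ip S v v"
  unfolding sq_def ip_def of_real_sum
  by (intro sum.cong refl) (simp add: complex_norm_square mult.commute flip: of_real_power)

lemma sq_eq_Re_ip: "sq S v = Re (ip S v v)"
  by (simp flip: of_real_sq)

lemma sq_eq_0_iff: "finite S \<Longrightarrow> sq S v = 0 \<longleftrightarrow> (\<forall>i\<in>S. v i = 0)"
  by (simp add: sq_def sum_nonneg_eq_0_iff)

lemma ip_add_right: "ip S u (\<lambda>i. v i + w i) = ip S u v + ip S u w"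
  by (simp add: ip_def distrib_left sum.distrib)

lemma ip_add_left: "ip S (\<lambda>i. v i + w i) u = ip S v u + ip S w u"
  by (simp add: ip_def distrib_right sum.distrib)

lemma ip_diff_right: "ip S u (\<lambda>i. v i - w i) = ip S u v - ip S u w"
  by (simp add: ip_def right_diff_distrib sum_subtractf)

lemma ip_scale_right: "ip S u (\<lambda>i. t * v i) = t * ip S u v"
  by (simp add: ip_def sum_distrib_left mult_ac)

lemma ip_sum_left: "ip S (\<lambda>i. \<Sum>k\<in>F. c k * h k i) u = (\<Sum>k\<in>F. cnj (c k) * ip S (h k) u)"
  unfolding ip_def sum_distrib_left cnj_sum sum_distrib_right
  by (subst sum.swap) (simp add: mult_ac)

lemma ip_sym: "ip S u v = cnj (ip S v u)"
  by (simp add: ip_def mult.commute)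

lemma ip_cong: "(\<And>i. i \<in> S \<Longrightarrow> u i = u' i) \<Longrightarrow> (\<And>i. i \<in> S \<Longrightarrow> v i = v' i) \<Longrightarrow> ip S u v = ip S u' v'"
  by (simp add: ip_def)

lemma sq_cong: "(\<And>i. i \<in> S \<Longrightarrow> u i = u' i) \<Longrightarrow> sq S u = sq S u'"
  by (simp add: sq_def)

lemma sq_add_orthogonal:
  assumes "ip S u v = 0"
  shows "sq S (\<lambda>i. u i + v i) = sq S u + sq S v"
proof -
  have "ip S v u = 0" using assms ip_sym[of S v u] by simp
  then show ?thesis using assms by (simp add: sq_eq_Re_ip ip_add_left ip_add_right)
qed

text \<open>For the projection coefficient \<open>t\<close> of \<open>e\<close> along
  \<open>g\<close>, Pythagoras says that subtracting \<open>t * g\<close> lowers the squared norm by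
  exactly \<open>(cmod t)\<^sup>2 * sq S g\<close>; minimality forces this to vanish.\<close>

lemma orthogonal_if_minimal:
  assumes fin: "finite S" and min: "\<And>t. sq S e \<le> sq S (\<lambda>i. e i - t * g i)"
  shows "ip S g e = 0"
proof (cases "sq S g = 0")
  case True
  then show ?thesis using fin by (simp add: sq_eq_0_iff ip_def)
next
  case False
  define t where "t = ip S g e / complex_of_real (sq S g)"
  define f where "f = (\<lambda>i. e i - t * g i)"
  have "ip S g f = 0"
    using False by (simp add: f_def ip_diff_right ip_scale_right t_def[symmetric] flip: of_real_sq)
      (simp add: t_def)
  then have "ip S f (\<lambda>i. t * g i) = 0"
    using ip_sym[of S f g] by (simp add: ip_scale_right)
  then have "sq S e = sq S f + sq S (\<lambda>i. t * g i)"
    using sq_add_orthogonal[of S f "\<lambda>i. t * g i"] by (simp add: f_def)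
  also have "sq S (\<lambda>i. t * g i) = (cmod t)\<^sup>2 * sq S g"
    by (simp add: sq_def norm_mult power_mult_distrib sum_distrib_left)
  finally have "(cmod t)\<^sup>2 * sq S g \<le> 0" using min[of t] by (simp add: f_def)
  moreover have "sq S g > 0" using False sq_nonneg[of S g] by simp
  ultimately have "t = 0" by (simp add: mult_le_0_iff)
  then show ?thesis using False by (simp add: t_def)
qed

text \<open>\<open>D\<close> is the matrix of the orthogonal projection onto the span of the vectors
  \<open>h k\<close> with \<open>k\<close> in \<open>F\<close>, described on \<open>S\<close> by its
  range and its residual. The label condition makes \<open>D\<close> block diagonal; this is what
  later keeps a projected factor inside its support pattern.\<close>

definition projector ::
    "'a set \<Rightarrow> ('k \<Rightarrow> 'a \<Rightarrow> complex) \<Rightarrow> ('a \<Rightarrow> 'l) \<Rightarrow> 'k set \<Rightarrow> ('a \<Rightarrow> 'a \<Rightarrow> complex) \<Rightarrow> bool" where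
  "projector S h \<rho> F D \<longleftrightarrow>
     (\<forall>v. \<exists>c. \<forall>x\<in>S. (\<Sum>x'\<in>S. D x x' * v x') = (\<Sum>k\<in>F. c k * h k x)) \<and>
     (\<forall>v. \<forall>k\<in>F. ip S (h k) (\<lambda>x. v x - (\<Sum>x'\<in>S. D x x' * v x')) = 0) \<and>
     (\<forall>x x'. D x x' \<noteq> 0 \<longrightarrow> \<rho> x = \<rho> x')"

text \<open>Gram-Schmidt, one vector per induction step. Each \<open>h k\<close> lives on a single
  label class, and projecting it onto the earlier vectors does not leave that class, so neither does
  the rank-one update built from the residual \<open>r\<close>.\<close>

lemma orthogonal_projector:
  assumes "finite S" and "finite F"
    and lab: "\<And>k x x'. k \<in> F \<Longrightarrow> h k x \<noteq> 0 \<Longrightarrow> h k x' \<noteq> 0 \<Longrightarrow> \<rho> x = \<rho> x'"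
  shows "\<exists>D. projector S h \<rho> F D"
  using assms(2) lab
proof (induction F rule: finite_induct)
  case empty
  show ?case by (rule exI[of _ "\<lambda>_ _. 0"]) (simp add: projector_def)
next
  case (insert k F)
  have "\<exists>D. projector S h \<rho> F D" using insert.IH insert.prems by blast
  then obtain D where D: "projector S h \<rho> F D" ..
  have span: "\<exists>c. \<forall>x\<in>S. (\<Sum>x'\<in>S. D x x' * v x') = (\<Sum>k\<in>F. c k * h k x)" for v
    using D unfolding projector_def by blast
  have orth: "ip S (h l) (\<lambda>x. v x - (\<Sum>x'\<in>S. D x x' * v x')) = 0" if "l \<in> F" for v l
    using D that unfolding projector_def by blast
  have labD: "\<rho> x = \<rho> x'" if "D x x' \<noteq> 0" for x x'
    using D that unfolding projector_def by blast
  define ap where "ap = (\<lambda>v x. \<Sum>x'\<in>S. D x x' * v x')"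
  have orth': "ip S (h l) (\<lambda>x. v x - ap v x) = 0" if "l \<in> F" for l v
    using orth[OF that, of v] by (simp add: ap_def)
  have span_orth: "ip S (ap v) w = 0" if "\<And>l. l \<in> F \<Longrightarrow> ip S (h l) w = 0" for v w
  proof -
    obtain c where c: "\<forall>x\<in>S. ap v x = (\<Sum>l\<in>F. c l * h l x)" using span[of v] unfolding ap_def by blast
    have "ip S (ap v) w = ip S (\<lambda>x. \<Sum>l\<in>F. c l * h l x) w" using c by (intro ip_cong) auto
    then show ?thesis using that by (simp add: ip_sum_left)
  qed
  define r where "r = (\<lambda>x. h k x - ap (h k) x)"
  have hk: "h k = (\<lambda>x. r x + ap (h k) x)" by (simp add: r_def)
  have r_orth: "ip S (h l) r = 0" if "l \<in> F" for l
    using orth'[OF that] by (simp add: r_def)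
  define D' where "D' = (\<lambda>x x'. D x x' + r x * cnj (r x') / complex_of_real (sq S r))"
  \<comment> \<open>If \<open>r\<close> vanishes on \<open>S\<close>, the added rank-one term vanishes too, since division by zero gives zero.\<close>
  have ap': "(\<Sum>x'\<in>S. D' x x' * v x') = ap v x + (ip S r v / complex_of_real (sq S r)) * r x" for v x
    unfolding D'_def ap_def ip_def distrib_right sum.distrib
    by (simp add: sum_distrib_left sum_divide_distrib mult_ac)
  show ?case
    unfolding projector_def
  proof (intro exI[of _ D'] conjI allI ballI impI)
    fix v
    obtain c where c: "\<forall>x\<in>S. ap v x = (\<Sum>l\<in>F. c l * h l x)" using span[of v] unfolding ap_def by blast
    obtain b where b: "\<forall>x\<in>S. ap (h k) x = (\<Sum>l\<in>F. b l * h l x)" using span[of "h k"] unfolding ap_def by blast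
    define t where "t = ip S r v / complex_of_real (sq S r)"
    \<comment> \<open>On \<open>S\<close>, \<open>r\<close> is \<open>h k\<close> minus the
      combination of the older vectors with coefficients \<open>b\<close>; adding
      \<open>t * r\<close> therefore puts \<open>t\<close> on \<open>h k\<close> and corrects the
      old coefficients by \<open>- t * b l\<close>.\<close>
    define e where "e = (\<lambda>l. if l = k then t else c l - t * b l)"
    have "(\<Sum>x'\<in>S. D' x x' * v x') = (\<Sum>l\<in>insert k F. e l * h l x)" if "x \<in> S" for x
    proof -
      have "(\<Sum>l\<in>F. e l * h l x) = (\<Sum>l\<in>F. (c l - t * b l) * h l x)"
        using insert.hyps by (intro sum.cong) (auto simp: e_def)
      also have "\<dots> = ap v x - t * ap (h k) x"
        using c b that unfolding left_diff_distrib sum_subtractf by (simp add: sum_distrib_left mult_ac)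
      finally have "(\<Sum>l\<in>insert k F. e l * h l x) = t * h k x + (ap v x - t * ap (h k) x)"
        using insert.hyps by (simp add: e_def)
      then show ?thesis by (simp add: ap' t_def[symmetric]) (simp add: r_def algebra_simps)
    qed
    then show "\<exists>c. \<forall>x\<in>S. (\<Sum>x'\<in>S. D' x x' * v x') = (\<Sum>l\<in>insert k F. c l * h l x)" by blast
  next
    fix v l assume l: "l \<in> insert k F"
    define t where "t = ip S r v / complex_of_real (sq S r)"
    define w where "w = (\<lambda>x. v x - ap v x - t * r x)"
    have w: "ip S u w = ip S u (\<lambda>x. v x - ap v x) - t * ip S u r" for u
      using ip_diff_right[of S u "\<lambda>x. v x - ap v x" "\<lambda>x. t * r x"]
      by (simp add: w_def ip_scale_right)
    have F: "ip S (h l) w = 0" if "l \<in> F" for l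
      using that by (simp add: w r_orth orth')
    have "ip S r (ap v) = 0"
      using span_orth[of r v] r_orth ip_sym[of S r "ap v"] by simp
    then have "ip S r w = ip S r v - t * complex_of_real (sq S r)"
      by (simp add: w ip_diff_right of_real_sq)
    also have "\<dots> = 0"
    proof (cases "sq S r = 0")
      case True
      then have "ip S r v = 0" using assms(1) by (simp add: sq_eq_0_iff ip_def)
      then show ?thesis using True by simp
    qed (simp add: t_def)
    finally have "ip S (h k) w = 0"
      using span_orth[of w "h k"] F by (subst hk) (simp add: ip_add_left)
    then have "ip S (h l) w = 0" using l F by auto
    then show "ip S (h l) (\<lambda>x. v x - (\<Sum>x'\<in>S. D' x x' * v x')) = 0"
      by (simp add: ap' t_def[symmetric] w_def diff_diff_eq)
  next
    fix x x' assume nz: "D' x x' \<noteq> 0"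
    have r: "\<exists>y. h k y \<noteq> 0 \<and> \<rho> x = \<rho> y" if "r x \<noteq> 0" for x
    proof (cases "h k x = 0")
      case True
      with that have "ap (h k) x \<noteq> 0" by (simp add: r_def)
      then obtain z where "D x z * h k z \<noteq> 0" unfolding ap_def by (meson sum.not_neutral_contains_not_neutral)
      then show ?thesis using labD by auto
    qed auto
    show "\<rho> x = \<rho> x'"
    proof (cases "D x x' = 0")
      case True
      then have "r x \<noteq> 0" "r x' \<noteq> 0" using nz by (auto simp: D'_def)
      then show ?thesis using r insert.prems by (metis insertI1)
    qed (rule labD)
  qed
qed

section \<open>Frobenius norm and matrix products\<close>

lemma fnorm_eq_sq: "fnorm m n M = sqrt (sq ({..<m} \<times> {..<n}) (\<lambda>(i, j). M i j))"
  unfolding fnorm_def sq_def sum.cartesian_product by (simp add: case_prod_beta)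

lemma fnorm_sq: "(fnorm m n M)\<^sup>2 = sq ({..<m} \<times> {..<n}) (\<lambda>(i, j). M i j)"
  by (simp add: fnorm_eq_sq sq_nonneg)

lemma fnorm_sq_cols: "(fnorm m n M)\<^sup>2 = (\<Sum>y<n. sq {..<m} (\<lambda>x. M x y))"
  unfolding fnorm_def sq_def by (subst sum.swap) (simp add: sum_nonneg)

lemma fnorm_nonneg: "0 \<le> fnorm m n M"
  by (simp add: fnorm_def sum_nonneg)

lemma fnorm_cong: "(\<And>i j. i < m \<Longrightarrow> j < n \<Longrightarrow> M i j = M' i j) \<Longrightarrow> fnorm m n M = fnorm m n M'"
  by (simp add: fnorm_def)

lemma fnorm_triangle: "fnorm m n (\<lambda>i j. A i j - C i j) \<le> fnorm m n (\<lambda>i j. A i j - B i j) + fnorm m n (\<lambda>i j. B i j - C i j)"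
proof -
  let ?S = "{..<m} \<times> {..<n}"
  have L2: "fnorm m n M = L2_set (\<lambda>p. cmod (M (fst p) (snd p))) ?S" for M
    by (simp add: fnorm_eq_sq sq_def L2_set_def case_prod_beta)
  have "fnorm m n (\<lambda>i j. A i j - C i j) \<le> L2_set (\<lambda>p. cmod (A (fst p) (snd p) - B (fst p) (snd p)) + cmod (B (fst p) (snd p) - C (fst p) (snd p))) ?S"
    unfolding L2 by (intro L2_set_mono) (metis dist_norm dist_triangle, simp)
  also have "\<dots> \<le> fnorm m n (\<lambda>i j. A i j - B i j) + fnorm m n (\<lambda>i j. B i j - C i j)"
    unfolding L2 by (rule L2_set_triangle_ineq)
  finally show ?thesis .
qed

lemma fnorm_transpose: "fnorm n m (\<lambda>i j. M j i) = fnorm m n M"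
  unfolding fnorm_def by (subst sum.swap) simp

lemma mmul_assoc: "mmul l (mmul k X Y) Z = mmul k X (mmul l Y Z)"
proof (intro ext)
  fix i j
  have "mmul l (mmul k X Y) Z i j = (\<Sum>t<l. \<Sum>u<k. X i u * Y u t * Z t j)"
    by (simp add: mmul_def sum_distrib_right)
  also have "\<dots> = (\<Sum>u<k. \<Sum>t<l. X i u * Y u t * Z t j)" by (rule sum.swap)
  also have "\<dots> = mmul k X (mmul l Y Z) i j" by (simp add: mmul_def sum_distrib_left mult_ac)
  finally show "mmul l (mmul k X Y) Z i j = mmul k X (mmul l Y Z) i j" .
qed

lemma mmul_diff_right: "mmul k X (\<lambda>i j. M i j - M' i j) i j = mmul k X M i j - mmul k X M' i j"
  by (simp add: mmul_def right_diff_distrib sum_subtractf)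

lemma mmul_neq_0E:
  assumes "mmul k X Y i j \<noteq> 0"
  obtains t where "t < k" "X i t \<noteq> 0" "Y t j \<noteq> 0"
  using assms unfolding mmul_def
  by (metis (mono_tags, lifting) lessThan_iff mult_eq_0_iff sum.not_neutral_contains_not_neutral)

section \<open>Support predicates, sets of two-factor products, and best approximation in
  them\<close>

definition supported :: "(nat \<Rightarrow> nat \<Rightarrow> bool) \<Rightarrow> cmat \<Rightarrow> bool" where
  "supported P X \<longleftrightarrow> (\<forall>x k. X x k \<noteq> 0 \<longrightarrow> P x k)"

definition cutset :: "nat \<Rightarrow> (nat \<Rightarrow> nat \<Rightarrow> bool) \<Rightarrow> (nat \<Rightarrow> nat \<Rightarrow> bool) \<Rightarrow> cmat set" where
  "cutset K P Q = {mmul K X Y | X Y. supported P X \<and> supported Q Y}"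

definition fits :: "nat \<Rightarrow> nat \<Rightarrow> (nat \<Rightarrow> nat \<Rightarrow> bool) \<Rightarrow> bool" where
  "fits a b P \<longleftrightarrow> (\<forall>x k. P x k \<longrightarrow> x < a \<and> k < b)"

text \<open>Rows that meet in some column of \<open>P\<close> have identical rows in
  \<open>P'\<close>. A matrix that mixes only such rows thus maps \<open>P'\<close>-supported
  matrices to \<open>P'\<close>-supported ones.\<close>

definition refines :: "(nat \<Rightarrow> nat \<Rightarrow> bool) \<Rightarrow> (nat \<Rightarrow> nat \<Rightarrow> bool) \<Rightarrow> bool" where
  "refines P P' \<longleftrightarrow> (\<forall>x x' k k'. P x k \<longrightarrow> P x' k \<longrightarrow> P' x k' \<longrightarrow> P' x' k')"

lemma fits_transpose: "fits a b P \<Longrightarrow> fits b a (\<lambda>k x. P x k)"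
  by (auto simp: fits_def)

lemma supported_transpose: "supported P X \<Longrightarrow> supported (\<lambda>k x. P x k) (\<lambda>k x. X x k)"
  by (auto simp: supported_def)

lemma cutsetI: "supported P X \<Longrightarrow> supported Q Y \<Longrightarrow> mmul K X Y \<in> cutset K P Q"
  by (auto simp: cutset_def)

lemma cutsetE:
  assumes "Z \<in> cutset K P Q"
  obtains X Y where "Z = mmul K X Y" "supported P X" "supported Q Y"
  using assms by (auto simp: cutset_def)

definition best_approx :: "nat \<Rightarrow> nat \<Rightarrow> cmat \<Rightarrow> cmat \<Rightarrow> cmat set \<Rightarrow> bool" where
  "best_approx m n A A' C \<longleftrightarrow> A' \<in> C \<and>
     (\<forall>Z\<in>C. fnorm m n (\<lambda>i j. A i j - A' i j) \<le> fnorm m n (\<lambda>i j. A i j - Z i j))"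

lemma best_approxD: "best_approx m n A A' C \<Longrightarrow> A' \<in> C"
  by (simp add: best_approx_def)

lemma best_approx_le:
  "best_approx m n A A' C \<Longrightarrow> Z \<in> C \<Longrightarrow>
    fnorm m n (\<lambda>i j. A i j - A' i j) \<le> fnorm m n (\<lambda>i j. A i j - Z i j)"
  by (simp add: best_approx_def)

text \<open>With the left factor \<open>H\<close> frozen, the products \<open>mmul K H V\<close>
  form a linear space inside the cut set, and the best approximation is in particular optimal along
  every line of it.\<close>

lemma best_approx_orthogonal:
  assumes best: "best_approx m n A (mmul K H W) (cutset K P Q)"
    and H: "supported P H" and W: "supported Q W" and V: "supported Q V"
  shows "ip ({..<m} \<times> {..<n}) (\<lambda>(i, j). mmul K H V i j) (\<lambda>(i, j). A i j - mmul K H W i j) = 0"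
proof (rule orthogonal_if_minimal)
  fix t :: complex
  let ?Z = "mmul K H (\<lambda>k j. W k j + t * V k j)"
  have "supported Q (\<lambda>k j. W k j + t * V k j)" using W V unfolding supported_def by (metis add.right_neutral mult_zero_right)
  then have "?Z \<in> cutset K P Q" using H by (intro cutsetI)
  then have "(fnorm m n (\<lambda>i j. A i j - mmul K H W i j))\<^sup>2 \<le> (fnorm m n (\<lambda>i j. A i j - ?Z i j))\<^sup>2"
    using best by (intro power_mono fnorm_nonneg) (auto simp: best_approx_def)
  moreover have "?Z i j = mmul K H W i j + t * mmul K H V i j" for i j
    by (simp add: mmul_def distrib_left sum.distrib sum_distrib_left mult_ac)
  ultimately show "sq ({..<m} \<times> {..<n}) (\<lambda>(i, j). A i j - mmul K H W i j)
      \<le> sq ({..<m} \<times> {..<n}) (\<lambda>p. (case p of (i, j) \<Rightarrow> A i j - mmul K H W i j) - t * (case p of (i, j) \<Rightarrow> mmul K H V i j))"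
    unfolding fnorm_sq by (simp add: case_prod_unfold diff_diff_eq)
qed simp

text \<open>Lets the transfer and extension lemmas on the row side be read off from those on the
  column side.\<close>

lemma best_approx_transpose:
  assumes "best_approx m n A A' (cutset K P Q)"
  shows "best_approx n m (\<lambda>i j. A j i) (\<lambda>i j. A' j i) (cutset K (\<lambda>y k. Q k y) (\<lambda>k x. P x k))"
  unfolding best_approx_def
proof (intro conjI ballI)
  obtain X Y where XY: "A' = mmul K X Y" "supported P X" "supported Q Y"
    using best_approxD[OF assms] by (rule cutsetE)
  have "(\<lambda>i j. A' j i) = mmul K (\<lambda>i j. Y j i) (\<lambda>i j. X j i)"
    by (intro ext) (simp add: XY(1) mmul_def mult.commute)
  then show "(\<lambda>i j. A' j i) \<in> cutset K (\<lambda>y k. Q k y) (\<lambda>k x. P x k)"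
    using XY by (auto intro!: cutsetI simp: supported_def)
next
  fix Z assume "Z \<in> cutset K (\<lambda>y k. Q k y) (\<lambda>k x. P x k)"
  then obtain Y X where XY: "Z = mmul K Y X" "supported (\<lambda>y k. Q k y) Y" "supported (\<lambda>k x. P x k) X"
    by (rule cutsetE)
  have "(\<lambda>i j. Z j i) = mmul K (\<lambda>i j. X j i) (\<lambda>i j. Y j i)"
    by (intro ext) (simp add: XY(1) mmul_def mult.commute)
  then have "(\<lambda>i j. Z j i) \<in> cutset K P Q"
    using XY by (auto intro!: cutsetI simp: supported_def)
  from best_approx_le[OF assms this]
  have "fnorm m n (\<lambda>i j. A i j - A' i j) \<le> fnorm m n (\<lambda>i j. A i j - Z j i)" .
  then show "fnorm n m (\<lambda>i j. A j i - A' j i) \<le> fnorm n m (\<lambda>i j. A j i - Z i j)"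
    using fnorm_transpose[of n m "\<lambda>i j. A i j - A' i j"] fnorm_transpose[of n m "\<lambda>i j. A i j - Z j i"] by simp
qed

text \<open>Column by column, a best approximation is the orthogonal projection of \<open>A\<close> onto the span of the
  columns of \<open>H\<close> that the support pattern \<open>Q\<close> makes available.\<close>

lemma best_approx_eq_projection:
  assumes best: "best_approx m n A A' (cutset K P Q)"
    and Qb: "fits K n Q"
    and PP': "refines P P'"
    and QQ': "refines (\<lambda>y k. Q' k y) (\<lambda>y k. Q k y)"
  shows "\<exists>\<Phi>. (\<forall>x<m. \<forall>y<n. A' x y = \<Phi> A x y) \<and>
    (\<forall>B C. fnorm m n (\<lambda>i j. \<Phi> B i j - \<Phi> C i j) \<le> fnorm m n (\<lambda>i j. B i j - C i j)) \<and>
    (\<forall>X' Y'. supported P' X' \<longrightarrow> supported Q' Y' \<longrightarrow>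
      (\<exists>X''. supported P' X'' \<and> \<Phi> (mmul K' X' Y') = mmul K' X'' Y'))"
proof -
  obtain H W where HW: "A' = mmul K H W" "supported P H" "supported Q W"
    using best_approxD[OF best] by (rule cutsetE)
  define h where "h = (\<lambda>k x. H x k)"
  define F where "F = (\<lambda>y. {k. Q k y})"
  \<comment> \<open>The label of a row is its row support in \<open>P'\<close>. By
    \<open>PP'\<close> all rows where a given column of \<open>H\<close> is nonzero carry the same
    label.\<close>
  define lbl where "lbl = (\<lambda>x. {k. P' x k})"
  have finF: "finite (F y)" for y
    by (rule finite_subset[of _ "{..<K}"]) (use Qb in \<open>auto simp: F_def fits_def\<close>)
  have "\<exists>D. projector {..<m} h lbl (F y) D" for y
  proof (rule orthogonal_projector)
    fix k x x' assume "h k x \<noteq> 0" "h k x' \<noteq> 0"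
    then have "P x k" "P x' k" using HW by (auto simp: h_def supported_def)
    then show "lbl x = lbl x'" using PP' unfolding lbl_def refines_def by blast
  qed (use finF in auto)
  \<comment> \<open>The projector is chosen as a function of the index set \<open>F y\<close>, not
    of \<open>y\<close>: columns with the same available vectors get literally the same matrix,
    which is needed to pull the projection through \<open>Y'\<close>.\<close>
  define D where "D = (\<lambda>F. SOME D. projector {..<m} h lbl F D)"
  have D: "projector {..<m} h lbl (F y) (D (F y))" for y
    unfolding D_def using \<open>\<exists>D. projector {..<m} h lbl (F y) D\<close> by (rule someI_ex)
  define ap where "ap = (\<lambda>y v x. \<Sum>x'<m. D (F y) x x' * v x')"
  have span: "\<exists>c. \<forall>x<m. ap y v x = (\<Sum>k\<in>F y. c k * h k x)" for y v
    using D[of y] unfolding projector_def ap_def by (metis lessThan_iff)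
  have orth: "ip {..<m} (h k) (\<lambda>x. v x - ap y v x) = 0" if "k \<in> F y" for y v k
    using D[of y] that unfolding projector_def ap_def by blast
  have lab: "P' x k \<longleftrightarrow> P' x' k" if "D (F y) x x' \<noteq> 0" for x x' y k
    using D[of y] that unfolding projector_def lbl_def by blast
  have span_orth: "ip {..<m} u w = 0"
    if "\<And>k. k \<in> F y \<Longrightarrow> ip {..<m} (h k) w = 0" "\<forall>x<m. u x = (\<Sum>k\<in>F y. c k * h k x)" for u w y c
  proof -
    have "ip {..<m} u w = ip {..<m} (\<lambda>x. \<Sum>k\<in>F y. c k * h k x) w" using that by (intro ip_cong) auto
    then show ?thesis using that by (simp add: ip_sum_left)
  qed
  have contr: "sq {..<m} (ap y v) \<le> sq {..<m} v" for y v
  proof -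
    obtain c where "\<forall>x<m. ap y v x = (\<Sum>k\<in>F y. c k * h k x)" using span by blast
    then have "ip {..<m} (ap y v) (\<lambda>x. v x - ap y v x) = 0" using orth by (rule span_orth[rotated])
    from sq_add_orthogonal[OF this] show ?thesis using sq_nonneg[of "{..<m}" "\<lambda>x. v x - ap y v x"] by simp
  qed
  define \<Phi> where "\<Phi> = (\<lambda>B x y. ap y (\<lambda>x'. B x' y) x)"
  have eq: "A' x y = \<Phi> A x y" if "x < m" "y < n" for x y
  proof -
    have A'_span: "A' x y = (\<Sum>k\<in>F y. W k y * h k x)" for x
    proof -
      have "(\<Sum>k\<in>F y. W k y * h k x) = (\<Sum>k<K. W k y * h k x)"
        using HW(3) Qb by (intro sum.mono_neutral_left) (auto simp: F_def supported_def fits_def)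
      then show ?thesis by (simp add: HW(1) mmul_def h_def mult.commute)
    qed
    have A'_orth: "ip {..<m} (h k) (\<lambda>x. A x y - A' x y) = 0" if k: "k \<in> F y" for k
    proof -
      \<comment> \<open>A matrix unit: \<open>mmul K H V\<close> is column \<open>k\<close> of
        \<open>H\<close> placed at column \<open>y\<close>, so global orthogonality turns into
        orthogonality in that single column.\<close>
      define V :: cmat where "V = (\<lambda>k' y'. if k' = k \<and> y' = y then 1 else 0)"
      have kK: "k < K" and V: "supported Q V" using k Qb by (auto simp: V_def F_def supported_def fits_def)
      have HV: "mmul K H V i j = (if j = y then H i k else 0)" for i j
        using kK by (simp add: mmul_def V_def if_distrib[of "\<lambda>z. _ * z"] cong: if_cong)
      have "0 = (\<Sum>i<m. \<Sum>j<n. cnj (mmul K H V i j) * (A i j - A' i j))"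
        using best_approx_orthogonal[of m n A K H W P Q V] best HW V
        by (simp add: ip_def sum.cartesian_product case_prod_beta)
      also have "\<dots> = (\<Sum>i<m. cnj (H i k) * (A i y - A' i y))"
        using \<open>y < n\<close> by (simp add: HV if_distrib[of cnj] if_distrib[of "\<lambda>z. z * _"] cong: if_cong)
      finally show ?thesis by (simp add: ip_def h_def)
    qed
    obtain c where c: "\<forall>x<m. ap y (\<lambda>x. A x y) x = (\<Sum>k\<in>F y. c k * h k x)" using span by blast
    let ?u = "\<lambda>x. ap y (\<lambda>x. A x y) x - A' x y"
    \<comment> \<open>The two candidates for the projection of column \<open>y\<close> differ by a
      vector that is both in the span and orthogonal to it.\<close>
    have "ip {..<m} ?u ?u = 0"
    proof (rule span_orth[where y = y and c = "\<lambda>k. c k - W k y"])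
      show "\<forall>x<m. ?u x = (\<Sum>k\<in>F y. (c k - W k y) * h k x)"
        using c A'_span by (simp add: left_diff_distrib sum_subtractf)
    next
      fix k assume "k \<in> F y"
      from A'_orth[OF this] orth[OF this, of "\<lambda>x. A x y"]
      show "ip {..<m} (h k) ?u = 0" by (simp add: ip_diff_right)
    qed
    then have "sq {..<m} ?u = 0" by (simp add: sq_eq_Re_ip)
    then show ?thesis using that by (simp add: sq_eq_0_iff \<Phi>_def)
  qed
  have contr\<Phi>: "fnorm m n (\<lambda>i j. \<Phi> B i j - \<Phi> C i j) \<le> fnorm m n (\<lambda>i j. B i j - C i j)" for B C
  proof (rule power2_le_imp_le)
    have "\<Phi> B x y - \<Phi> C x y = ap y (\<lambda>x. B x y - C x y) x" for x y
      by (simp add: \<Phi>_def ap_def right_diff_distrib sum_subtractf)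
    then show "(fnorm m n (\<lambda>i j. \<Phi> B i j - \<Phi> C i j))\<^sup>2 \<le> (fnorm m n (\<lambda>i j. B i j - C i j))\<^sup>2"
      unfolding fnorm_sq_cols by (auto intro!: sum_mono contr)
  qed (rule fnorm_nonneg)
  have "\<exists>X''. supported P' X'' \<and> \<Phi> (mmul K' X' Y') = mmul K' X'' Y'"
    if X': "supported P' X'" and Y': "supported Q' Y'" for X' Y'
  proof -
    \<comment> \<open>\<open>g k\<close> is any column that row \<open>k\<close> of
      \<open>Q'\<close> reaches; by \<open>QQ'\<close> all of them have the same set
      \<open>F\<close>. If row \<open>k\<close> of \<open>Q'\<close> is empty the choice is
      arbitrary, but then row \<open>k\<close> of \<open>Y'\<close> vanishes.\<close>
    define g where "g = (\<lambda>k. SOME y. Q' k y)"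
    define X'' where "X'' = (\<lambda>x k. \<Sum>x'<m. D (F (g k)) x x' * X' x' k)"
    have Fg: "F (g k) = F y" if "Q' k y" for k y
      using QQ' that someI[of "Q' k" y] unfolding F_def g_def refines_def by blast
    have "supported P' X''"
      unfolding supported_def
    proof (intro allI impI)
      fix x k assume "X'' x k \<noteq> 0"
      then obtain x' where "D (F (g k)) x x' * X' x' k \<noteq> 0"
        unfolding X''_def by (meson sum.not_neutral_contains_not_neutral)
      then show "P' x k" using lab X' unfolding supported_def by (metis mult_eq_0_iff)
    qed
    moreover have "\<Phi> (mmul K' X' Y') x y = mmul K' X'' Y' x y" for x y
    proof -
      have "\<Phi> (mmul K' X' Y') x y = (\<Sum>x'<m. \<Sum>k<K'. D (F y) x x' * (X' x' k * Y' k y))"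
        by (simp add: \<Phi>_def ap_def mmul_def sum_distrib_left)
      also have "\<dots> = (\<Sum>k<K'. \<Sum>x'<m. D (F y) x x' * (X' x' k * Y' k y))" by (rule sum.swap)
      also have "\<dots> = (\<Sum>k<K'. \<Sum>x'<m. D (F (g k)) x x' * (X' x' k * Y' k y))"
      proof (intro sum.cong refl)
        fix k x'
        show "D (F y) x x' * (X' x' k * Y' k y) = D (F (g k)) x x' * (X' x' k * Y' k y)"
          using Fg[of k y] Y' unfolding supported_def by (cases "Y' k y = 0") auto
      qed
      also have "\<dots> = mmul K' X'' Y' x y"
        by (simp add: X''_def mmul_def sum_distrib_right mult.assoc)
      finally show ?thesis .
    qed
    ultimately show ?thesis by blast
  qed
  then show ?thesis using eq contr\<Phi> by blast
qed

section \<open>Best approximations in a family of cuts\<close>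

lemma fnorm_eq_0D: "fnorm m n M = 0 \<Longrightarrow> i < m \<Longrightarrow> j < n \<Longrightarrow> M i j = 0"
  by (force simp: fnorm_eq_sq sq_eq_0_iff sq_nonneg)

text \<open>One contraction \<open>\<Phi>\<close> sends \<open>A\<close> to \<open>A'\<close> and
  the competitor to a product with the same right factor \<open>Y'\<close>.\<close>

lemma best_approx_transfer_left:
  assumes best: "best_approx m n A A' (cutset K P Q)" and Qb: "fits K n Q"
    and PP': "refines P P'" and QQ': "refines (\<lambda>y k. Q' k y) (\<lambda>y k. Q k y)"
    and X': "supported P' X'" and Y': "supported Q' Y'"
  shows "\<exists>X''. supported P' X'' \<and>
    fnorm m n (\<lambda>i j. A' i j - mmul r X'' Y' i j) \<le> fnorm m n (\<lambda>i j. A i j - mmul r X' Y' i j)"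
proof -
  obtain \<Phi> where eq: "\<forall>x<m. \<forall>y<n. A' x y = \<Phi> A x y"
    and contr: "\<forall>B C. fnorm m n (\<lambda>i j. \<Phi> B i j - \<Phi> C i j) \<le> fnorm m n (\<lambda>i j. B i j - C i j)"
    and keep: "\<forall>X' Y'. supported P' X' \<longrightarrow> supported Q' Y' \<longrightarrow>
      (\<exists>X''. supported P' X'' \<and> \<Phi> (mmul r X' Y') = mmul r X'' Y')"
    using best_approx_eq_projection[OF best Qb PP' QQ', of r] by (elim exE conjE)
  from keep X' Y' obtain X'' where X'': "supported P' X''" "\<Phi> (mmul r X' Y') = mmul r X'' Y'" by blast
  have "fnorm m n (\<lambda>i j. A' i j - mmul r X'' Y' i j) = fnorm m n (\<lambda>i j. \<Phi> A i j - \<Phi> (mmul r X' Y') i j)"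
    by (intro fnorm_cong) (simp add: eq X'')
  also have "\<dots> \<le> fnorm m n (\<lambda>i j. A i j - mmul r X' Y' i j)" by (rule contr[rule_format])
  finally show ?thesis using X''(1) by blast
qed

text \<open>Transposed version. That the left factor \<open>X'\<close> stays the same is essential
  for the square-root bound, where a fixed left factor has to survive all later cuts.\<close>

lemma best_approx_transfer_right:
  assumes best: "best_approx m n A A' (cutset K P Q)" and Pb: "fits m K P"
    and QQ': "refines (\<lambda>y k. Q k y) (\<lambda>y k. Q' k y)" and PP': "refines P' P"
    and X': "supported P' X'" and Y': "supported Q' Y'"
  shows "\<exists>Y''. supported Q' Y'' \<and>
    fnorm m n (\<lambda>i j. A' i j - mmul r X' Y'' i j) \<le> fnorm m n (\<lambda>i j. A i j - mmul r X' Y' i j)"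
proof -
  obtain V where V: "supported (\<lambda>y k. Q' k y) V"
    and le: "fnorm n m (\<lambda>i j. A' j i - mmul r V (\<lambda>k x. X' x k) i j)
      \<le> fnorm n m (\<lambda>i j. A j i - mmul r (\<lambda>y k. Y' k y) (\<lambda>k x. X' x k) i j)"
    using best_approx_transfer_left[OF best_approx_transpose[OF best] fits_transpose[OF Pb] QQ' PP'
        supported_transpose[OF Y'] supported_transpose[OF X'], of r] by blast
  have tr: "mmul r V (\<lambda>k x. X' x k) i j = mmul r X' (\<lambda>k y. V y k) j i" for V i j
    by (simp add: mmul_def mult.commute)
  have "fnorm m n (\<lambda>i j. A' i j - mmul r X' (\<lambda>k y. V y k) i j) \<le> fnorm m n (\<lambda>i j. A i j - mmul r X' Y' i j)"
    using le fnorm_transpose[of n m "\<lambda>i j. A' i j - mmul r X' (\<lambda>k y. V y k) i j"]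
      fnorm_transpose[of n m "\<lambda>i j. A i j - mmul r X' Y' i j"]
    by (simp add: tr)
  then show ?thesis using supported_transpose[OF V] by blast
qed

text \<open>\<open>K s\<close> is the inner dimension at cut \<open>s\<close>. The two refinement
  conditions are the only link between different cuts: they admit column projections for cuts
  further right and row projections for cuts further left.\<close>

locale cut_family =
  fixes m n L :: nat and K :: "nat \<Rightarrow> nat" and P Q :: "nat \<Rightarrow> nat \<Rightarrow> nat \<Rightarrow> bool"
  assumes P_fits: "s \<in> {1..<L} \<Longrightarrow> fits m (K s) (P s)"
    and Q_fits: "s \<in> {1..<L} \<Longrightarrow> fits (K s) n (Q s)"
    and P_refines: "s \<in> {1..<L} \<Longrightarrow> s' \<in> {1..<L} \<Longrightarrow> s < s' \<Longrightarrow> refines (P s) (P s')"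
    and Q_refines: "s \<in> {1..<L} \<Longrightarrow> s' \<in> {1..<L} \<Longrightarrow> s < s' \<Longrightarrow>
      refines (\<lambda>y k. Q s' k y) (\<lambda>y k. Q s k y)"
begin

abbreviation cut :: "nat \<Rightarrow> cmat set" where
  "cut s \<equiv> cutset (K s) (P s) (Q s)"

lemma distance_to_cut_mono:
  assumes s: "s \<in> {1..<L}" and s': "s' \<in> {1..<L}"
    and best: "best_approx m n A A' (cut s)" and Z: "Z \<in> cut s'"
  shows "\<exists>Z'\<in>cut s'. fnorm m n (\<lambda>i j. A' i j - Z' i j) \<le> fnorm m n (\<lambda>i j. A i j - Z i j)"
proof -
  obtain X Y where XY: "Z = mmul (K s') X Y" "supported (P s') X" "supported (Q s') Y"
    using Z by (rule cutsetE)
  consider "s = s'" | "s < s'" | "s' < s" by linarith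
  then show ?thesis
  proof cases
    case 1
    have "fnorm m n (\<lambda>i j. A' i j - A' i j) \<le> fnorm m n (\<lambda>i j. A i j - Z i j)"
      using fnorm_nonneg[of m n] by (simp add: fnorm_def)
    then show ?thesis using best_approxD[OF best] 1 by blast
  next
    case 2
    from best_approx_transfer_left[OF best Q_fits[OF s] P_refines[OF s s' 2] Q_refines[OF s s' 2] XY(2,3), of "K s'"]
    obtain X' where X': "supported (P s') X'"
      "fnorm m n (\<lambda>i j. A' i j - mmul (K s') X' Y i j) \<le> fnorm m n (\<lambda>i j. A i j - Z i j)"
      unfolding XY(1) by blast
    show ?thesis using X'(2) cutsetI[OF X'(1) XY(3)] by (rule bexI)
  next
    case 3
    from best_approx_transfer_right[OF best P_fits[OF s] Q_refines[OF s' s 3] P_refines[OF s' s 3] XY(2,3), of "K s'"]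
    obtain Y' where Y': "supported (Q s') Y'"
      "fnorm m n (\<lambda>i j. A' i j - mmul (K s') X Y' i j) \<le> fnorm m n (\<lambda>i j. A i j - Z i j)"
      unfolding XY(1) by blast
    show ?thesis using Y'(2) cutsetI[OF XY(2) Y'(1)] by (rule bexI)
  qed
qed

lemma step_error_le:
  assumes \<sigma>: "\<sigma> ` {1..<L} \<subseteq> {1..<L}"
    and best: "\<And>J. J \<in> {1..<L} \<Longrightarrow> best_approx m n (B J) (B (Suc J)) (cut (\<sigma> J))"
    and Z: "\<And>s. s \<in> {1..<L} \<Longrightarrow> Z \<in> cut s"
    and J: "J \<in> {1..<L}"
  shows "fnorm m n (\<lambda>i j. B J i j - B (Suc J) i j) \<le> fnorm m n (\<lambda>i j. B 1 i j - Z i j)"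
proof -
  let ?\<delta> = "fnorm m n (\<lambda>i j. B 1 i j - Z i j)"
  \<comment> \<open>The claim covers all cuts simultaneously, each with its own \<open>Z'\<close>: a
    step at one cut must preserve the bound for those cuts whose turn comes later.\<close>
  have "J < L \<Longrightarrow> \<forall>s\<in>{1..<L}. \<exists>Z'\<in>cut s. fnorm m n (\<lambda>i j. B J i j - Z' i j) \<le> ?\<delta>" if "1 \<le> J" for J
    using that
  proof (induction J rule: dec_induct)
    case base
    then show ?case using Z by blast
  next
    case (step J)
    show ?case
    proof
      fix s assume s: "s \<in> {1..<L}"
      obtain Z' where Z': "Z' \<in> cut s" "fnorm m n (\<lambda>i j. B J i j - Z' i j) \<le> ?\<delta>"
        using step.IH step.hyps step.prems s by (meson Suc_lessD)
      have "J \<in> {1..<L}" using step.hyps step.prems by simp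
      then have "\<sigma> J \<in> {1..<L}" using \<sigma> by blast
      from distance_to_cut_mono[OF this s best[OF \<open>J \<in> {1..<L}\<close>] Z'(1)]
      show "\<exists>Z'\<in>cut s. fnorm m n (\<lambda>i j. B (Suc J) i j - Z' i j) \<le> ?\<delta>"
        using Z'(2) order.trans by blast
    qed
  qed
  moreover have "\<sigma> J \<in> {1..<L}" using \<sigma> J by blast
  ultimately obtain Z' where Z': "Z' \<in> cut (\<sigma> J)" "fnorm m n (\<lambda>i j. B J i j - Z' i j) \<le> ?\<delta>"
    using J by (meson atLeastLessThan_iff)
  show ?thesis using best_approx_le[OF best[OF J] Z'(1)] Z'(2) by linarith
qed

lemma total_error_le:
  assumes \<sigma>: "\<sigma> ` {1..<L} \<subseteq> {1..<L}"
    and best: "\<And>J. J \<in> {1..<L} \<Longrightarrow> best_approx m n (B J) (B (Suc J)) (cut (\<sigma> J))"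
    and Z: "\<And>s. s \<in> {1..<L} \<Longrightarrow> Z \<in> cut s"
    and L: "1 \<le> L"
  shows "fnorm m n (\<lambda>i j. B 1 i j - B L i j) \<le> (real L - 1) * fnorm m n (\<lambda>i j. B 1 i j - Z i j)"
proof -
  let ?\<delta> = "fnorm m n (\<lambda>i j. B 1 i j - Z i j)"
  have "J \<le> L \<Longrightarrow> fnorm m n (\<lambda>i j. B 1 i j - B J i j) \<le> (real J - 1) * ?\<delta>" if "1 \<le> J" for J
    using that
  proof (induction J rule: dec_induct)
    case base
    then show ?case by (simp add: fnorm_def)
  next
    case (step J)
    have "fnorm m n (\<lambda>i j. B 1 i j - B (Suc J) i j)
        \<le> fnorm m n (\<lambda>i j. B 1 i j - B J i j) + fnorm m n (\<lambda>i j. B J i j - B (Suc J) i j)"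
      by (rule fnorm_triangle)
    also have "\<dots> \<le> (real J - 1) * ?\<delta> + ?\<delta>"
      using step step_error_le[OF \<sigma> best Z, of J] by (intro add_mono) auto
    finally show ?case by (simp add: algebra_simps)
  qed
  then show ?thesis using L by blast
qed

text \<open>When the cuts are made from left to right, every later iterate stays in the linear space
  \<open>{H W'}\<close> spanned by the left factor \<open>H\<close> of the current one, to which the current error is orthogonal.\<close>

lemma total_error_le_sqrt:
  assumes best: "\<And>J. J \<in> {1..<L} \<Longrightarrow> best_approx m n (B J) (B (Suc J)) (cut J)"
    and Z: "\<And>s. s \<in> {1..<L} \<Longrightarrow> Z \<in> cut s"
    and L: "1 \<le> L"
  shows "fnorm m n (\<lambda>i j. B 1 i j - B L i j) \<le> sqrt (real L - 1) * fnorm m n (\<lambda>i j. B 1 i j - Z i j)"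
proof -
  let ?\<delta> = "fnorm m n (\<lambda>i j. B 1 i j - Z i j)"
  have pyth: "(fnorm m n (\<lambda>i j. B J i j - B L i j))\<^sup>2
      = (fnorm m n (\<lambda>i j. B J i j - B (Suc J) i j))\<^sup>2 + (fnorm m n (\<lambda>i j. B (Suc J) i j - B L i j))\<^sup>2"
    if J: "J \<in> {1..<L}" for J
  proof -
    obtain H W where HW: "B (Suc J) = mmul (K J) H W" "supported (P J) H" "supported (Q J) W"
      using best_approxD[OF best[OF J]] by (rule cutsetE)
    have "M \<le> L \<Longrightarrow> \<exists>V. supported (Q J) V \<and> (\<forall>x<m. \<forall>y<n. B M x y = mmul (K J) H V x y)"
      if "Suc J \<le> M" for M
      using that
    proof (induction M rule: dec_induct)
      case base
      then show ?case using HW by auto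
    next
      case (step M)
      then obtain V where V: "supported (Q J) V" "\<forall>x<m. \<forall>y<n. B M x y = mmul (K J) H V x y" by auto
      have M: "M \<in> {1..<L}" "J < M" using step by auto
      \<comment> \<open>Applied to a competitor at distance zero: since \<open>B M\<close> equals
        \<open>H V\<close> on the index range, the next iterate is at distance zero from some
        \<open>H V'\<close>.\<close>
      from best_approx_transfer_right[OF best[OF M(1)] P_fits[OF M(1)] Q_refines[OF J M] P_refines[OF J M] HW(2) V(1), of "K J"]
      obtain V' where V': "supported (Q J) V'"
        "fnorm m n (\<lambda>i j. B (Suc M) i j - mmul (K J) H V' i j) \<le> fnorm m n (\<lambda>i j. B M i j - mmul (K J) H V i j)"
        by blast
      have "fnorm m n (\<lambda>i j. B M i j - mmul (K J) H V i j) = 0"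
        using V(2) by (simp add: fnorm_def)
      then have "fnorm m n (\<lambda>i j. B (Suc M) i j - mmul (K J) H V' i j) = 0"
        using V'(2) fnorm_nonneg[of m n "\<lambda>i j. B (Suc M) i j - mmul (K J) H V' i j"] by linarith
      from fnorm_eq_0D[OF this] show ?case using V'(1) by auto
    qed
    from this[of L] J obtain V where
      V: "supported (Q J) V" "\<forall>x<m. \<forall>y<n. B L x y = mmul (K J) H V x y" by auto
    let ?S = "{..<m} \<times> {..<n}"
    let ?e = "\<lambda>(i, j). B J i j - B (Suc J) i j" and ?f = "\<lambda>(i, j). B (Suc J) i j - B L i j"
    \<comment> \<open>Both \<open>B (Suc J)\<close> and \<open>B L\<close> have left factor
      \<open>H\<close>, so their difference is \<open>H (W - V)\<close>, a direction to which the
      error of step \<open>J\<close> is orthogonal.\<close>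
    have WV: "supported (Q J) (\<lambda>i j. W i j - V i j)"
      using HW(3) V(1) unfolding supported_def by (metis diff_zero)
    have "ip ?S ?f ?e = ip ?S (\<lambda>(i, j). mmul (K J) H (\<lambda>i j. W i j - V i j) i j) (\<lambda>(i, j). B J i j - mmul (K J) H W i j)"
      using V(2) by (intro ip_cong) (auto simp: mmul_diff_right HW(1))
    also have "\<dots> = 0"
      using best[OF J] HW WV by (intro best_approx_orthogonal[where P = "P J" and Q = "Q J"]) auto
    finally have "ip ?S ?e ?f = 0" using ip_sym[of ?S ?e ?f] by simp
    from sq_add_orthogonal[OF this] show ?thesis
      unfolding fnorm_sq by (simp add: case_prod_unfold)
  qed
  \<comment> \<open>Backward induction: \<open>k\<close> counts the steps still to be made, each
    contributing at most \<open>?\<delta>\<^sup>2\<close> through the Pythagorean identity.\<close>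
  have "(fnorm m n (\<lambda>i j. B (L - k) i j - B L i j))\<^sup>2 \<le> real k * ?\<delta>\<^sup>2" if "k < L" for k
    using that
  proof (induction k)
    case 0
    then show ?case by (simp add: fnorm_def)
  next
    case (Suc k)
    have J: "L - Suc k \<in> {1..<L}" and SJ: "Suc (L - Suc k) = L - k" using Suc by auto
    have "fnorm m n (\<lambda>i j. B (L - Suc k) i j - B (L - k) i j) \<le> ?\<delta>"
      using step_error_le[of "\<lambda>J. J" B Z "L - Suc k"] best Z J SJ by simp
    then have "(fnorm m n (\<lambda>i j. B (L - Suc k) i j - B (L - k) i j))\<^sup>2 \<le> ?\<delta>\<^sup>2"
      by (intro power_mono fnorm_nonneg)
    then show ?case using pyth[OF J] Suc SJ by (simp add: algebra_simps)
  qed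
  from this[of "L - 1"] L have "(fnorm m n (\<lambda>i j. B 1 i j - B L i j))\<^sup>2 \<le> (real L - 1) * ?\<delta>\<^sup>2"
    by (simp add: of_nat_diff)
  then have "fnorm m n (\<lambda>i j. B 1 i j - B L i j) \<le> sqrt ((real L - 1) * ?\<delta>\<^sup>2)"
    by (rule real_le_rsqrt)
  then show ?thesis by (simp add: real_sqrt_mult fnorm_nonneg)
qed

end

section \<open>Extending a best approximation by orthonormal neighbours\<close>

text \<open>Orthonormality is asked only of columns of \<open>X\<close> whose indices meet in a
  column of \<open>T\<close>. Other pairs never occur together when a column of \<open>E\<close> is
  multiplied by \<open>X\<close>, so the norm is preserved column by column.\<close>

lemma mmul_isometry:
  assumes orth: "\<And>y k k'. T k y \<Longrightarrow> T k' y \<Longrightarrow> ip {..<m} (\<lambda>x. X x k) (\<lambda>x. X x k') = (if k = k' then 1 else 0)"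
    and E: "supported T E"
  shows "fnorm m n (mmul K X E) = fnorm K n E"
proof -
  have "sq {..<m} (\<lambda>x. mmul K X E x y) = sq {..<K} (\<lambda>k. E k y)" for y
  proof -
    let ?I = "\<lambda>k k'. ip {..<m} (\<lambda>x. X x k) (\<lambda>x. X x k')"
    have expand: "(\<lambda>x. mmul K X E x y) = (\<lambda>x. \<Sum>k<K. E k y * X x k)"
      by (simp add: mmul_def mult.commute)
    have inner: "ip {..<m} u (\<lambda>x. \<Sum>k<K. E k y * X x k) = (\<Sum>k<K. E k y * ip {..<m} u (\<lambda>x. X x k))" for u
      by (subst ip_sym, subst ip_sum_left) (simp add: ip_sym[of _ u])
    have "ip {..<m} (\<lambda>x. mmul K X E x y) (\<lambda>x. mmul K X E x y)
        = (\<Sum>k<K. cnj (E k y) * (\<Sum>k'<K. E k' y * ?I k k'))"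
      unfolding expand ip_sum_left[where h = "\<lambda>k x. X x k"] inner ..
    also have "\<dots> = (\<Sum>k<K. cnj (E k y) * (\<Sum>k'<K. if k = k' then E k' y else 0))"
    proof (intro sum.cong refl)
      fix k
      show "cnj (E k y) * (\<Sum>k'<K. E k' y * ?I k k') = cnj (E k y) * (\<Sum>k'<K. if k = k' then E k' y else 0)"
      proof (cases "E k y = 0")
        case False
        then have "T k y" using E by (simp add: supported_def)
        then have "E k' y * ?I k k' = (if k = k' then E k' y else 0)" for k'
          using orth[of k y k'] E by (cases "E k' y = 0") (auto simp: supported_def)
        then show ?thesis by simp
      qed simp
    qed
    also have "\<dots> = ip {..<K} (\<lambda>k. E k y) (\<lambda>k. E k y)"
      by (simp add: ip_def)
    finally show ?thesis by (simp add: sq_eq_Re_ip)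
  qed
  then have "(fnorm m n (mmul K X E))\<^sup>2 = (fnorm K n E)\<^sup>2" by (simp add: fnorm_sq_cols)
  then show ?thesis using fnorm_nonneg by (simp add: power2_eq_iff_nonneg)
qed

text \<open>With \<open>W\<close> the masked compression of \<open>Z\<close> by the adjoint of
  \<open>X\<close>, the difference \<open>X M - Z\<close> splits as
  \<open>X (M - W) + (X W - Z)\<close>. In each column the second part is orthogonal to the
  admissible columns of \<open>X\<close>, and the first part has the norm of
  \<open>M - W\<close>.\<close>

lemma mmul_bessel:
  assumes orth: "\<And>y k k'. T k y \<Longrightarrow> T k' y \<Longrightarrow> ip {..<m} (\<lambda>x. X x k) (\<lambda>x. X x k') = (if k = k' then 1 else 0)"
    and Tb: "\<And>k y. T k y \<Longrightarrow> k < K"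
    and M: "supported T M"
  shows "fnorm K n (\<lambda>k y. M k y - (if T k y then ip {..<m} (\<lambda>x. X x k) (\<lambda>x. Z x y) else 0))
         \<le> fnorm m n (\<lambda>x y. mmul K X M x y - Z x y)"
proof (rule power2_le_imp_le)
  define W where "W = (\<lambda>k y. if T k y then ip {..<m} (\<lambda>x. X x k) (\<lambda>x. Z x y) else 0)"
  define E where "E = (\<lambda>k y. M k y - W k y)"
  have E: "supported T E" using M by (auto simp: E_def W_def supported_def)
  have "sq {..<m} (\<lambda>x. mmul K X M x y - Z x y) =
     sq {..<m} (\<lambda>x. mmul K X E x y) + sq {..<m} (\<lambda>x. mmul K X W x y - Z x y)" for y
  proof -
    have expand: "(\<lambda>x. mmul K X V x y) = (\<lambda>x. \<Sum>k<K. V k y * X x k)" for V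
      by (simp add: mmul_def mult.commute)
    have inner: "ip {..<m} u (\<lambda>x. \<Sum>k<K. W k y * X x k) = (\<Sum>k<K. W k y * ip {..<m} u (\<lambda>x. X x k))" for u
      by (subst ip_sym, subst ip_sum_left) (simp add: ip_sym[of _ u])
    have 0: "ip {..<m} (\<lambda>x. X x k) (\<lambda>x. mmul K X W x y - Z x y) = 0" if "T k y" for k
    proof -
      have "ip {..<m} (\<lambda>x. X x k) (\<lambda>x. mmul K X W x y) = (\<Sum>k'<K. W k' y * ip {..<m} (\<lambda>x. X x k) (\<lambda>x. X x k'))"
        unfolding expand inner ..
      also have "\<dots> = (\<Sum>k'<K. if k = k' then W k' y else 0)"
        using orth[OF that] by (intro sum.cong refl) (auto simp: W_def)
      also have "\<dots> = ip {..<m} (\<lambda>x. X x k) (\<lambda>x. Z x y)" using Tb[OF that] that by (simp add: W_def)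
      finally show ?thesis by (simp add: ip_diff_right)
    qed
    have "ip {..<m} (\<lambda>x. mmul K X E x y) (\<lambda>x. mmul K X W x y - Z x y)
      = (\<Sum>k<K. cnj (E k y) * ip {..<m} (\<lambda>x. X x k) (\<lambda>x. mmul K X W x y - Z x y))"
      unfolding expand[of E] ip_sum_left[where h = "\<lambda>k x. X x k"] ..
    also have "\<dots> = 0" using 0 E by (intro sum.neutral) (auto simp: supported_def)
    finally have "ip {..<m} (\<lambda>x. mmul K X E x y) (\<lambda>x. mmul K X W x y - Z x y) = 0" .
    from sq_add_orthogonal[OF this] show ?thesis
      by (simp add: E_def mmul_diff_right)
  qed
  then have "(fnorm m n (\<lambda>x y. mmul K X M x y - Z x y))\<^sup>2
      = (fnorm m n (mmul K X E))\<^sup>2 + (fnorm m n (\<lambda>x y. mmul K X W x y - Z x y))\<^sup>2"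
    by (simp add: fnorm_sq_cols sum.distrib)
  also have "fnorm m n (mmul K X E) = fnorm K n E" using orth E by (rule mmul_isometry)
  finally show "(fnorm K n (\<lambda>k y. M k y - (if T k y then ip {..<m} (\<lambda>x. X x k) (\<lambda>x. Z x y) else 0)))\<^sup>2
    \<le> (fnorm m n (\<lambda>x y. mmul K X M x y - Z x y))\<^sup>2"
    by (simp add: E_def W_def)
qed (rule fnorm_nonneg)

text \<open>Every competitor \<open>Z\<close> of the large problem compresses, by the adjoint of
  \<open>X\<close>, to a competitor of the small problem that is at most as far from
  \<open>M\<close>; multiplication by \<open>X\<close> preserves the error of \<open>M'\<close>. The
  support conditions say that \<open>U\<close> composes with \<open>P'\<close> into \<open>P\<close>
  and that this composition can be cancelled inside \<open>T\<close>.\<close>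

lemma best_approx_extend_left:
  assumes best: "best_approx K n M M' (cutset r P' Q)"
    and orth: "\<And>y k k'. T k y \<Longrightarrow> T k' y \<Longrightarrow> ip {..<m} (\<lambda>x. X x k) (\<lambda>x. X x k') = (if k = k' then 1 else 0)"
    and Tb: "\<And>k y. T k y \<Longrightarrow> k < K"
    and M: "supported T M" and X: "supported U X"
    and T: "\<And>k l y. P' k l \<Longrightarrow> Q l y \<Longrightarrow> T k y"
    and UP': "\<And>x k l. U x k \<Longrightarrow> P' k l \<Longrightarrow> P x l"
    and P': "\<And>x k l y. T k y \<Longrightarrow> Q l y \<Longrightarrow> U x k \<Longrightarrow> P x l \<Longrightarrow> P' k l"
  shows "best_approx m n (mmul K X M) (mmul K X M') (cutset r P Q)"
  unfolding best_approx_def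
proof (intro conjI ballI)
  obtain H W where HW: "M' = mmul r H W" "supported P' H" "supported Q W"
    using best_approxD[OF best] by (rule cutsetE)
  have "supported P (mmul K X H)"
    unfolding supported_def
  proof (intro allI impI)
    fix x l assume "mmul K X H x l \<noteq> 0"
    then obtain k where "X x k \<noteq> 0" "H k l \<noteq> 0" by (rule mmul_neq_0E)
    then show "P x l" using UP' X HW(2) unfolding supported_def by blast
  qed
  then show "mmul K X M' \<in> cutset r P Q"
    unfolding HW(1) mmul_assoc[symmetric] using HW(3) by (rule cutsetI)
  have M': "supported T M'"
    unfolding supported_def
  proof (intro allI impI)
    fix k y assume "M' k y \<noteq> 0"
    then obtain l where "H k l \<noteq> 0" "W l y \<noteq> 0" unfolding HW(1) by (rule mmul_neq_0E)
    then show "T k y" using T HW(2,3) unfolding supported_def by blast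
  qed
  fix Z assume "Z \<in> cutset r P Q"
  then obtain Z1 Z2 where Z: "Z = mmul r Z1 Z2" "supported P Z1" "supported Q Z2"
    by (rule cutsetE)
  \<comment> \<open>Compressing \<open>Z1 Z2\<close> amounts to compressing \<open>Z1\<close> alone;
    the mask enforces the support \<open>P'\<close>.\<close>
  define V where "V = (\<lambda>k l. if P' k l then ip {..<m} (\<lambda>x. X x k) (\<lambda>x. Z1 x l) else 0)"
  have V: "supported P' V" by (simp add: V_def supported_def)
  have eq: "(if T k y then ip {..<m} (\<lambda>x. X x k) (\<lambda>x. Z x y) else 0) = mmul r V Z2 k y" for k y
  proof (cases "T k y")
    case True
    have "ip {..<m} (\<lambda>x. X x k) (\<lambda>x. Z x y) = (\<Sum>x<m. \<Sum>l<r. cnj (X x k) * Z1 x l * Z2 l y)"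
      by (simp add: ip_def Z(1) mmul_def sum_distrib_left mult.assoc)
    also have "\<dots> = (\<Sum>l<r. \<Sum>x<m. cnj (X x k) * Z1 x l * Z2 l y)" by (rule sum.swap)
    also have "\<dots> = (\<Sum>l<r. ip {..<m} (\<lambda>x. X x k) (\<lambda>x. Z1 x l) * Z2 l y)"
      by (simp add: ip_def sum_distrib_right)
    also have "\<dots> = mmul r V Z2 k y"
      unfolding mmul_def
    proof (intro sum.cong refl)
      fix l
      \<comment> \<open>The mask loses nothing: by the cancellation condition, for \<open>k\<close>,
        \<open>l\<close> outside \<open>P'\<close> column \<open>k\<close> of \<open>X\<close> and
        column \<open>l\<close> of \<open>Z1\<close> have no common row.\<close>
      have "ip {..<m} (\<lambda>x. X x k) (\<lambda>x. Z1 x l) = 0" if "\<not> P' k l" "Z2 l y \<noteq> 0"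
      proof -
        have "Q l y" using that Z(3) by (simp add: supported_def)
        then have "X x k = 0 \<or> Z1 x l = 0" for x
          using P'[OF True, of l x] that X Z(2) unfolding supported_def by blast
        then show ?thesis unfolding ip_def by (intro sum.neutral) auto
      qed
      then show "ip {..<m} (\<lambda>x. X x k) (\<lambda>x. Z1 x l) * Z2 l y = V k l * Z2 l y"
        by (cases "Z2 l y = 0") (auto simp: V_def)
    qed
    finally show ?thesis using True by simp
  next
    case False
    have "mmul r V Z2 k y = 0"
    proof (rule ccontr)
      assume "mmul r V Z2 k y \<noteq> 0"
      then obtain l where "V k l \<noteq> 0" "Z2 l y \<noteq> 0" by (rule mmul_neq_0E)
      then show False using T False V Z(3) unfolding supported_def by blast
    qed
    then show ?thesis using False by simp
  qed
  have "fnorm m n (\<lambda>i j. mmul K X M i j - mmul K X M' i j) = fnorm m n (mmul K X (\<lambda>i j. M i j - M' i j))"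
    by (intro fnorm_cong) (simp add: mmul_diff_right)
  also have "\<dots> = fnorm K n (\<lambda>i j. M i j - M' i j)"
    using orth
  proof (rule mmul_isometry)
    show "supported T (\<lambda>i j. M i j - M' i j)" using M M' unfolding supported_def by (metis diff_zero)
  qed
  also have "\<dots> \<le> fnorm K n (\<lambda>i j. M i j - mmul r V Z2 i j)"
    using best cutsetI[OF V Z(3)] by (rule best_approx_le)
  also have "\<dots> \<le> fnorm m n (\<lambda>i j. mmul K X M i j - Z i j)"
    unfolding eq[symmetric] using orth Tb M by (rule mmul_bessel)
  finally show "fnorm m n (\<lambda>i j. mmul K X M i j - mmul K X M' i j) \<le> fnorm m n (\<lambda>i j. mmul K X M i j - Z i j)" .
qed

lemma best_approx_extend_right:
  assumes best: "best_approx m K M M' (cutset r P Q')"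
    and orth: "\<And>x k k'. T x k \<Longrightarrow> T x k' \<Longrightarrow> ip {..<n} (X k) (X k') = (if k = k' then 1 else 0)"
    and Tb: "\<And>x k. T x k \<Longrightarrow> k < K"
    and M: "supported T M" and X: "supported U X"
    and T: "\<And>x l k. P x l \<Longrightarrow> Q' l k \<Longrightarrow> T x k"
    and UQ': "\<And>l k y. Q' l k \<Longrightarrow> U k y \<Longrightarrow> Q l y"
    and Q': "\<And>x l k y. T x k \<Longrightarrow> P x l \<Longrightarrow> U k y \<Longrightarrow> Q l y \<Longrightarrow> Q' l k"
  shows "best_approx m n (mmul K M X) (mmul K M' X) (cutset r P Q)"
proof -
  have "best_approx n m (mmul K (\<lambda>y k. X k y) (\<lambda>k x. M x k)) (mmul K (\<lambda>y k. X k y) (\<lambda>k x. M' x k))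
     (cutset r (\<lambda>y l. Q l y) (\<lambda>l x. P x l))"
  proof (rule best_approx_extend_left[OF best_approx_transpose[OF best],
        where T = "\<lambda>k x. T x k" and U = "\<lambda>y k. U k y"])
    fix y k k' assume "T y k" "T y k'"
    from orth[OF this] show "ip {..<n} (\<lambda>x. X k x) (\<lambda>x. X k' x) = (if k = k' then 1 else 0)" .
  next
    show "supported (\<lambda>k x. T x k) (\<lambda>i j. M j i)" "supported (\<lambda>y k. U k y) (\<lambda>y k. X k y)"
      using M X by (auto simp: supported_def)
    show "k < K" if "T x k" for k x using that by (rule Tb)
    show "T x k" if "Q' l k" "P x l" for k l x using that(2,1) by (rule T)
    show "Q l y" if "U k y" "Q' l k" for y k l using that(2,1) by (rule UQ')
    show "Q' l k" if "T x k" "P x l" "U k y" "Q l y" for y k l x using that by (rule Q')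
  qed
  from best_approx_transpose[OF this]
  have "best_approx m n (\<lambda>i j. mmul K (\<lambda>y k. X k y) (\<lambda>k x. M x k) j i)
    (\<lambda>i j. mmul K (\<lambda>y k. X k y) (\<lambda>k x. M' x k) j i) (cutset r P Q)" .
  moreover have "(\<lambda>i j. mmul K (\<lambda>y k. X k y) (\<lambda>k x. N x k) j i) = mmul K N X" for N
    by (intro ext) (simp add: mmul_def mult.commute)
  ultimately show ?thesis by simp
qed

section \<open>Blocks of a pair of patterns\<close>

lemma is_factor_eq_supported: "is_factor \<pi> = supported (supp \<pi>)"
  by (auto simp: is_factor_def supported_def)

lemma Urank1_nonzero: "Urank1 \<pi> \<pi>' i x y \<noteq> 0 \<longleftrightarrow> supp \<pi> x i \<and> supp \<pi>' i y"
  by (simp add: Urank1_def Smat_def)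

lemma Urank1_eqI:
  assumes "\<And>x. supp \<pi> x i \<longleftrightarrow> supp \<pi> x j" "\<And>y. supp \<pi>' i y \<longleftrightarrow> supp \<pi>' j y"
  shows "Urank1 \<pi> \<pi>' i = Urank1 \<pi> \<pi>' j"
  using assms by (intro ext) (simp add: Urank1_def Smat_def)

text \<open>A support is an equality of two invariants, a quotient and a residue, of row and column
  index; hence two columns of \<open>supp \<pi>\<close> sharing a row coincide, and likewise two
  rows of \<open>supp \<pi>'\<close> sharing a column. Blocks of different classes are therefore
  disjoint.\<close>

lemma Urank1_eq_if_common_entry:
  assumes "supp \<pi> x i" "supp \<pi>' i y" "supp \<pi> x j" "supp \<pi>' j y"
  shows "Urank1 \<pi> \<pi>' i = Urank1 \<pi> \<pi>' j"
  using assms by (intro Urank1_eqI) (auto simp: supp_def)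

lemma classesE:
  assumes "P \<in> classes \<pi> \<pi>'"
  obtains i where "i < pcol \<pi>" "P = {j. j < pcol \<pi> \<and> Urank1 \<pi> \<pi>' j = Urank1 \<pi> \<pi>' i}" "i \<in> P"
  using assms unfolding classes_def by blast

lemma class_of:
  assumes "i < pcol \<pi>"
  obtains P where "P \<in> classes \<pi> \<pi>'" "i \<in> P"
  using assms unfolding classes_def by blast

lemma classes_mem:
  assumes "P \<in> classes \<pi> \<pi>'" "i \<in> P"
  shows "j \<in> P \<longleftrightarrow> j < pcol \<pi> \<and> Urank1 \<pi> \<pi>' j = Urank1 \<pi> \<pi>' i"
  using assms by (elim classesE) auto

lemma classes_disjoint:
  assumes "P \<in> classes \<pi> \<pi>'" "P' \<in> classes \<pi> \<pi>'" "i \<in> P" "i \<in> P'"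
  shows "P = P'"
  using classes_mem[OF assms(1,3)] classes_mem[OF assms(2,4)] by blast

lemma finite_classes: "finite (classes \<pi> \<pi>')"
proof -
  have "classes \<pi> \<pi>' = (\<lambda>i. {j. j < pcol \<pi> \<and> Urank1 \<pi> \<pi>' j = Urank1 \<pi> \<pi>' i}) ` {..<pcol \<pi>}"
    by (auto simp: classes_def)
  then show ?thesis by simp
qed

text \<open>The existential accounts for a class whose rank-one matrix is zero because one side is
  empty; both index sets of its block are then empty.\<close>

lemma rowsP_eq:
  assumes "P \<in> classes \<pi> \<pi>'" "i \<in> P"
  shows "rowsP \<pi> \<pi>' P = {x. supp \<pi> x i \<and> (\<exists>y. supp \<pi>' i y)}"
proof -
  have "Urank1 \<pi> \<pi>' j = Urank1 \<pi> \<pi>' i" if "j \<in> P" for j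
    using classes_mem[OF assms] that by blast
  with assms(2) have "rowsP \<pi> \<pi>' P = {x. \<exists>y. Urank1 \<pi> \<pi>' i x y \<noteq> 0}"
    unfolding rowsP_def by (intro Collect_cong) metis
  then show ?thesis unfolding Urank1_nonzero by auto
qed

lemma colsP_eq:
  assumes "P \<in> classes \<pi> \<pi>'" "i \<in> P"
  shows "colsP \<pi> \<pi>' P = {y. supp \<pi>' i y \<and> (\<exists>x. supp \<pi> x i)}"
proof -
  have "Urank1 \<pi> \<pi>' j = Urank1 \<pi> \<pi>' i" if "j \<in> P" for j
    using classes_mem[OF assms] that by blast
  with assms(2) have "colsP \<pi> \<pi>' P = {y. \<exists>x. Urank1 \<pi> \<pi>' i x y \<noteq> 0}"
    unfolding colsP_def by (intro Collect_cong) metis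
  then show ?thesis unfolding Urank1_nonzero by auto
qed

lemma block_iff:
  assumes "P \<in> classes \<pi> \<pi>'" "i \<in> P"
  shows "x \<in> rowsP \<pi> \<pi>' P \<and> y \<in> colsP \<pi> \<pi>' P \<longleftrightarrow> supp \<pi> x i \<and> supp \<pi>' i y"
  using rowsP_eq[OF assms] colsP_eq[OF assms] by auto

lemma mem_class_if_block:
  assumes P: "P \<in> classes \<pi> \<pi>'" and x: "x \<in> rowsP \<pi> \<pi>' P" and y: "y \<in> colsP \<pi> \<pi>' P"
    and k: "supp \<pi> x k" "supp \<pi>' k y"
  shows "k \<in> P"
proof -
  obtain i where i: "i \<in> P" using P by (rule classesE)
  then have "supp \<pi> x i" "supp \<pi>' i y" using block_iff[OF P i] x y by auto
  then have "Urank1 \<pi> \<pi>' k = Urank1 \<pi> \<pi>' i" using k by (intro Urank1_eq_if_common_entry)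
  then show ?thesis using classes_mem[OF P i] k(1) by (simp add: supp_def)
qed

lemma classes_subset: "P \<in> classes \<pi> \<pi>' \<Longrightarrow> P \<subseteq> {..<pcol \<pi>}"
  by (auto elim: classesE)

lemma rowsP_subset: "rowsP \<pi> \<pi>' P \<subseteq> {..<prow \<pi>}"
  unfolding rowsP_def Urank1_nonzero by (auto simp: supp_def)

lemma colsP_subset: "colsP \<pi> \<pi>' P \<subseteq> {..<pcol \<pi>'}"
  unfolding colsP_def Urank1_nonzero by (auto simp: supp_def)

lemma mmul_on_block:
  assumes X: "is_factor \<pi> X" and Y: "is_factor \<pi>' Y" and P: "P \<in> classes \<pi> \<pi>'"
    and x: "x \<in> rowsP \<pi> \<pi>' P" and y: "y \<in> colsP \<pi> \<pi>' P"
  shows "mmul (pcol \<pi>) X Y x y = (\<Sum>k\<in>P. X x k * Y k y)"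
  unfolding mmul_def
proof (rule sum.mono_neutral_right)
  show "\<forall>k\<in>{..<pcol \<pi>} - P. X x k * Y k y = 0"
  proof
    fix k assume "k \<in> {..<pcol \<pi>} - P"
    then have "\<not> (supp \<pi> x k \<and> supp \<pi>' k y)" using mem_class_if_block[OF P x y] by blast
    then show "X x k * Y k y = 0" using X Y unfolding is_factor_def by auto
  qed
qed (use classes_subset[OF P] in auto)

lemma mmul_off_blocks:
  assumes X: "is_factor \<pi> X" and Y: "is_factor \<pi>' Y"
    and off: "\<And>P. P \<in> classes \<pi> \<pi>' \<Longrightarrow> \<not> (x \<in> rowsP \<pi> \<pi>' P \<and> y \<in> colsP \<pi> \<pi>' P)"
  shows "mmul (pcol \<pi>) X Y x y = 0"
proof (rule ccontr)
  assume "mmul (pcol \<pi>) X Y x y \<noteq> 0"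
  then obtain k where k: "k < pcol \<pi>" "X x k \<noteq> 0" "Y k y \<noteq> 0" by (rule mmul_neq_0E)
  obtain P where "P \<in> classes \<pi> \<pi>'" "k \<in> P" using k(1) by (rule class_of)
  then show False using off[of P] block_iff[of P \<pi> \<pi>' k x y] X Y k unfolding is_factor_def by blast
qed

lemma is_factor_if_block_supported:
  assumes "block_supported \<pi> \<pi>' X Y"
  shows "is_factor \<pi> X" "is_factor \<pi>' Y"
proof -
  show "is_factor \<pi> X"
    unfolding is_factor_def
  proof (intro allI impI)
    fix x k assume "X x k \<noteq> 0"
    then obtain P where P: "P \<in> classes \<pi> \<pi>'" "x \<in> rowsP \<pi> \<pi>' P" "k \<in> P"
      using assms unfolding block_supported_def by blast
    then show "supp \<pi> x k" using rowsP_eq[OF P(1,3)] by blast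
  qed
  show "is_factor \<pi>' Y"
    unfolding is_factor_def
  proof (intro allI impI)
    fix k y assume "Y k y \<noteq> 0"
    then obtain P where P: "P \<in> classes \<pi> \<pi>'" "k \<in> P" "y \<in> colsP \<pi> \<pi>' P"
      using assms unfolding block_supported_def by blast
    then show "supp \<pi>' k y" using colsP_eq[OF P(1,2)] by blast
  qed
qed

section \<open>Blockwise analysis of TwoFactor and Ortho\<close>

text \<open>Blocks of distinct classes are disjoint and a product of factors vanishes outside them,
  so the error separates into independent block errors plus a remainder that depends on
  \<open>M\<close> only.\<close>

lemma fnorm_sq_blocks:
  assumes X: "is_factor \<pi> X" and Y: "is_factor \<pi>' Y"
  defines "Bl \<equiv> \<lambda>P. rowsP \<pi> \<pi>' P \<times> colsP \<pi> \<pi>' P"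
  shows "(fnorm (prow \<pi>) (pcol \<pi>') (\<lambda>i j. M i j - mmul (pcol \<pi>) X Y i j))\<^sup>2 =
    (\<Sum>P\<in>classes \<pi> \<pi>'. (blockerr \<pi> \<pi>' P M X Y)\<^sup>2) +
    sq ({..<prow \<pi>} \<times> {..<pcol \<pi>'} - (\<Union>P\<in>classes \<pi> \<pi>'. Bl P)) (\<lambda>(i, j). M i j)"
proof -
  let ?S = "{..<prow \<pi>} \<times> {..<pcol \<pi>'}" and ?U = "\<Union>P\<in>classes \<pi> \<pi>'. Bl P"
  let ?E = "\<lambda>(i, j). M i j - mmul (pcol \<pi>) X Y i j"
  have Bl_sub: "Bl P \<subseteq> ?S" for P
    unfolding Bl_def by (intro Sigma_mono rowsP_subset colsP_subset)
  have fin: "finite (Bl P)" for P by (rule finite_subset[OF Bl_sub]) simp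
  have disj: "Bl P \<inter> Bl P' = {}" if P: "P \<in> classes \<pi> \<pi>'" and P': "P' \<in> classes \<pi> \<pi>'" and ne: "P \<noteq> P'" for P P'
  proof (rule ccontr)
    assume "Bl P \<inter> Bl P' \<noteq> {}"
    then obtain x y where xy: "x \<in> rowsP \<pi> \<pi>' P" "y \<in> colsP \<pi> \<pi>' P" "x \<in> rowsP \<pi> \<pi>' P'" "y \<in> colsP \<pi> \<pi>' P'"
      unfolding Bl_def by auto
    obtain k where k: "k \<in> P" using P by (rule classesE)
    then have "supp \<pi> x k" "supp \<pi>' k y" using block_iff[OF P k, of x y] xy(1,2) by auto
    then have "k \<in> P'" using mem_class_if_block[OF P' xy(3,4)] by blast
    then show False using classes_disjoint[OF P P' k] ne by blast
  qed
  have block: "sq (Bl P) ?E = (blockerr \<pi> \<pi>' P M X Y)\<^sup>2" if P: "P \<in> classes \<pi> \<pi>'" for P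
  proof -
    have "(blockerr \<pi> \<pi>' P M X Y)\<^sup>2 = sq (Bl P) (\<lambda>(x, y). M x y - (\<Sum>k\<in>P. X x k * Y k y))"
      unfolding blockerr_def sq_def Bl_def sum.cartesian_product
      by (simp add: sum_nonneg case_prod_unfold)
    also have "\<dots> = sq (Bl P) ?E"
      using mmul_on_block[OF X Y P] by (intro sq_cong) (auto simp: Bl_def)
    finally show ?thesis ..
  qed
  have off: "sq (?S - ?U) ?E = sq (?S - ?U) (\<lambda>(i, j). M i j)"
  proof (rule sq_cong)
    fix p assume "p \<in> ?S - ?U"
    then have "mmul (pcol \<pi>) X Y (fst p) (snd p) = 0"
      by (intro mmul_off_blocks[OF X Y]) (auto simp: Bl_def mem_Times_iff)
    then show "?E p = (case p of (i, j) \<Rightarrow> M i j)" by (simp add: case_prod_unfold)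
  qed
  have "sq ?S ?E = sq (?S - ?U) ?E + sq ?U ?E"
    unfolding sq_def by (rule sum.subset_diff) (use Bl_sub in auto)
  also have "sq ?U ?E = (\<Sum>P\<in>classes \<pi> \<pi>'. sq (Bl P) ?E)"
    unfolding sq_def using fin disj by (intro sum.UNION_disjoint finite_classes) auto
  also have "\<dots> = (\<Sum>P\<in>classes \<pi> \<pi>'. (blockerr \<pi> \<pi>' P M X Y)\<^sup>2)"
    using block by (rule sum.cong[OF refl])
  finally show ?thesis unfolding fnorm_sq off by simp
qed

text \<open>Since the block problems are independent, solving each of them optimally is globally
  optimal.\<close>

lemma twofactor_best_approx:
  assumes "twofactor M \<pi> \<pi>' X Y"
  shows "best_approx (prow \<pi>) (pcol \<pi>') M (mmul (pcol \<pi>) X Y) (cutset (pcol \<pi>) (supp \<pi>) (supp \<pi>'))"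
  unfolding best_approx_def
proof (intro conjI ballI)
  have XY: "is_factor \<pi> X" "is_factor \<pi>' Y"
    using assms is_factor_if_block_supported unfolding twofactor_def by blast+
  then show "mmul (pcol \<pi>) X Y \<in> cutset (pcol \<pi>) (supp \<pi>) (supp \<pi>')"
    unfolding is_factor_eq_supported by (rule cutsetI)
  fix Z assume "Z \<in> cutset (pcol \<pi>) (supp \<pi>) (supp \<pi>')"
  then obtain H K where Z: "Z = mmul (pcol \<pi>) H K" "is_factor \<pi> H" "is_factor \<pi>' K"
    unfolding is_factor_eq_supported by (rule cutsetE)
  have "(blockerr \<pi> \<pi>' P M X Y)\<^sup>2 \<le> (blockerr \<pi> \<pi>' P M H K)\<^sup>2" if "P \<in> classes \<pi> \<pi>'" for P
  proof (rule power_mono)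
    show "blockerr \<pi> \<pi>' P M X Y \<le> blockerr \<pi> \<pi>' P M H K"
      using assms that unfolding twofactor_def by blast
  qed (simp add: blockerr_def sum_nonneg)
  then have "(fnorm (prow \<pi>) (pcol \<pi>') (\<lambda>i j. M i j - mmul (pcol \<pi>) X Y i j))\<^sup>2
      \<le> (fnorm (prow \<pi>) (pcol \<pi>') (\<lambda>i j. M i j - Z i j))\<^sup>2"
    unfolding Z(1) fnorm_sq_blocks[OF XY] fnorm_sq_blocks[OF Z(2,3)] by (intro add_right_mono sum_mono)
  then show "fnorm (prow \<pi>) (pcol \<pi>') (\<lambda>i j. M i j - mmul (pcol \<pi>) X Y i j)
      \<le> fnorm (prow \<pi>) (pcol \<pi>') (\<lambda>i j. M i j - Z i j)"
    using fnorm_nonneg by (rule power2_le_imp_le)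
qed

lemma ortho_ColumnE:
  assumes "ortho Column \<pi> \<pi>' X Y X' Y'" "P \<in> classes \<pi> \<pi>'"
  obtains R where
    "\<And>k l. k \<in> P \<Longrightarrow> l \<in> P \<Longrightarrow> (\<Sum>x\<in>rowsP \<pi> \<pi>' P. cnj (X' x k) * X' x l) = (if k = l then 1 else 0)"
    "\<And>x k. x \<in> rowsP \<pi> \<pi>' P \<Longrightarrow> k \<in> P \<Longrightarrow> X x k = (\<Sum>l\<in>P. X' x l * R l k)"
    "\<And>k y. k \<in> P \<Longrightarrow> y \<in> colsP \<pi> \<pi>' P \<Longrightarrow> Y' k y = (\<Sum>l\<in>P. R k l * Y l y)"
proof -
  obtain Q R where Q: "orthonormal_cols (rowsP \<pi> \<pi>' P) P Q"
    and X: "\<forall>x\<in>rowsP \<pi> \<pi>' P. \<forall>k\<in>P. X x k = (\<Sum>l\<in>P. Q x l * R l k)"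
    and X': "\<forall>x\<in>rowsP \<pi> \<pi>' P. \<forall>k\<in>P. X' x k = Q x k"
    and Y': "\<forall>k\<in>P. \<forall>y\<in>colsP \<pi> \<pi>' P. Y' k y = (\<Sum>l\<in>P. R k l * Y l y)"
    using bspec[OF conjunct2[OF assms(1)[unfolded ortho_def Let_def orient.case]] assms(2)] by (elim exE conjE)
  show thesis
  proof (rule that)
    fix k l assume "k \<in> P" "l \<in> P"
    then show "(\<Sum>x\<in>rowsP \<pi> \<pi>' P. cnj (X' x k) * X' x l) = (if k = l then 1 else 0)"
      using Q X' by (simp add: orthonormal_cols_def)
  qed (use X X' Y' in auto)
qed

lemma ortho_RowE:
  assumes "ortho Row \<pi> \<pi>' X Y X' Y'" "P \<in> classes \<pi> \<pi>'"
  obtains R where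
    "\<And>k l. k \<in> P \<Longrightarrow> l \<in> P \<Longrightarrow> (\<Sum>y\<in>colsP \<pi> \<pi>' P. cnj (Y' k y) * Y' l y) = (if k = l then 1 else 0)"
    "\<And>k y. y \<in> colsP \<pi> \<pi>' P \<Longrightarrow> k \<in> P \<Longrightarrow> Y k y = (\<Sum>l\<in>P. Y' l y * R l k)"
    "\<And>x k. x \<in> rowsP \<pi> \<pi>' P \<Longrightarrow> k \<in> P \<Longrightarrow> X' x k = (\<Sum>l\<in>P. X x l * R k l)"
proof -
  obtain Q R where Q: "orthonormal_cols (colsP \<pi> \<pi>' P) P Q"
    and Y: "\<forall>y\<in>colsP \<pi> \<pi>' P. \<forall>k\<in>P. Y k y = (\<Sum>l\<in>P. Q y l * R l k)"
    and X': "\<forall>x\<in>rowsP \<pi> \<pi>' P. \<forall>k\<in>P. X' x k = (\<Sum>l\<in>P. X x l * R k l)"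
    and Y': "\<forall>k\<in>P. \<forall>y\<in>colsP \<pi> \<pi>' P. Y' k y = Q y k"
    using bspec[OF conjunct2[OF assms(1)[unfolded ortho_def Let_def orient.case]] assms(2)] by (elim exE conjE)
  show thesis
  proof (rule that)
    fix k l assume "k \<in> P" "l \<in> P"
    then show "(\<Sum>y\<in>colsP \<pi> \<pi>' P. cnj (Y' k y) * Y' l y) = (if k = l then 1 else 0)"
      using Q Y' by (simp add: orthonormal_cols_def)
  qed (use Y X' Y' in auto)
qed

lemma ortho_is_factor:
  assumes "ortho u \<pi> \<pi>' X Y X' Y'"
  shows "is_factor \<pi> X'" "is_factor \<pi>' Y'"
  using assms is_factor_if_block_supported unfolding ortho_def by blast+

text \<open>On each block this is associativity, \<open>Q (R Y) = (Q R) Y\<close> and its row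
  analogue; off the blocks both products vanish.\<close>

lemma ortho_product:
  assumes o: "ortho u \<pi> \<pi>' X Y X' Y'" and X: "is_factor \<pi> X" and Y: "is_factor \<pi>' Y"
  shows "mmul (pcol \<pi>) X' Y' = mmul (pcol \<pi>) X Y"
proof (intro ext)
  fix x y
  note X' = ortho_is_factor[OF o]
  show "mmul (pcol \<pi>) X' Y' x y = mmul (pcol \<pi>) X Y x y"
  proof (cases "\<exists>P\<in>classes \<pi> \<pi>'. x \<in> rowsP \<pi> \<pi>' P \<and> y \<in> colsP \<pi> \<pi>' P")
    case False
    then show ?thesis using mmul_off_blocks[OF X Y, of x y] mmul_off_blocks[OF X', of x y] by auto
  next
    case True
    then obtain P where P: "P \<in> classes \<pi> \<pi>'" "x \<in> rowsP \<pi> \<pi>' P" "y \<in> colsP \<pi> \<pi>' P" by blast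
    have "(\<Sum>k\<in>P. X' x k * Y' k y) = (\<Sum>k\<in>P. X x k * Y k y)"
    proof (cases u)
      case Column
      obtain R where R: "\<And>x k. x \<in> rowsP \<pi> \<pi>' P \<Longrightarrow> k \<in> P \<Longrightarrow> X x k = (\<Sum>l\<in>P. X' x l * R l k)"
        "\<And>k y. k \<in> P \<Longrightarrow> y \<in> colsP \<pi> \<pi>' P \<Longrightarrow> Y' k y = (\<Sum>l\<in>P. R k l * Y l y)"
        using ortho_ColumnE[OF o[unfolded Column] P(1)] by metis
      have "(\<Sum>k\<in>P. X' x k * Y' k y) = (\<Sum>k\<in>P. \<Sum>l\<in>P. X' x k * R k l * Y l y)"
        using R(2) P by (simp add: sum_distrib_left mult.assoc)
      also have "\<dots> = (\<Sum>l\<in>P. \<Sum>k\<in>P. X' x k * R k l * Y l y)" by (rule sum.swap)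
      also have "\<dots> = (\<Sum>l\<in>P. X x l * Y l y)" using R(1) P by (simp add: sum_distrib_right)
      finally show ?thesis .
    next
      case Row
      obtain R where R: "\<And>k y. y \<in> colsP \<pi> \<pi>' P \<Longrightarrow> k \<in> P \<Longrightarrow> Y k y = (\<Sum>l\<in>P. Y' l y * R l k)"
        "\<And>x k. x \<in> rowsP \<pi> \<pi>' P \<Longrightarrow> k \<in> P \<Longrightarrow> X' x k = (\<Sum>l\<in>P. X x l * R k l)"
        using ortho_RowE[OF o[unfolded Row] P(1)] by metis
      have "(\<Sum>k\<in>P. X' x k * Y' k y) = (\<Sum>k\<in>P. \<Sum>l\<in>P. X x l * R k l * Y' k y)"
        using R(2) P by (simp add: sum_distrib_right)
      also have "\<dots> = (\<Sum>l\<in>P. \<Sum>k\<in>P. X x l * R k l * Y' k y)" by (rule sum.swap)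
      also have "\<dots> = (\<Sum>l\<in>P. X x l * Y l y)" using R(1) P by (simp add: sum_distrib_left mult_ac)
      finally show ?thesis .
    qed
    then show ?thesis using mmul_on_block[OF X Y P] mmul_on_block[OF X' P] by simp
  qed
qed

text \<open>QR gives orthonormality within a class. For indices of different classes,
  \<open>same\<close> says that their supports share no row, so the inner product has no nonzero
  term.\<close>

lemma ortho_Column_orthonormal:
  assumes o: "ortho Column \<pi> \<pi>' X Y X' Y'" and k: "k < pcol \<pi>" and l: "l < pcol \<pi>"
    and same: "\<And>x. supp \<pi> x k \<Longrightarrow> supp \<pi> x l \<Longrightarrow> Urank1 \<pi> \<pi>' k = Urank1 \<pi> \<pi>' l"
  shows "ip {..<prow \<pi>} (\<lambda>x. X' x k) (\<lambda>x. X' x l) = (if k = l then 1 else 0)"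
proof (cases "Urank1 \<pi> \<pi>' k = Urank1 \<pi> \<pi>' l")
  case True
  obtain P where P: "P \<in> classes \<pi> \<pi>'" "k \<in> P" using k by (rule class_of)
  have lP: "l \<in> P" using classes_mem[OF P] l True by simp
  have "ip {..<prow \<pi>} (\<lambda>x. X' x k) (\<lambda>x. X' x l) = (\<Sum>x\<in>rowsP \<pi> \<pi>' P. cnj (X' x k) * X' x l)"
    unfolding ip_def
  proof (rule sum.mono_neutral_right)
    have "X' x k = 0" if x: "x \<notin> rowsP \<pi> \<pi>' P" for x
    proof (rule ccontr)
      assume "X' x k \<noteq> 0"
      then obtain P' where P': "P' \<in> classes \<pi> \<pi>'" "x \<in> rowsP \<pi> \<pi>' P'" "k \<in> P'"
        using o unfolding ortho_def block_supported_def by blast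
      then show False using classes_disjoint[OF P(1) P'(1) P(2) P'(3)] x by blast
    qed
    then show "\<forall>x\<in>{..<prow \<pi>} - rowsP \<pi> \<pi>' P. cnj (X' x k) * X' x l = 0" by simp
  qed (use rowsP_subset in auto)
  also have "\<dots> = (if k = l then 1 else 0)" using o P(1) P(2) lP by (elim ortho_ColumnE)
  finally show ?thesis .
next
  case False
  have "X' x k = 0 \<or> X' x l = 0" for x
    using same[of x] False ortho_is_factor(1)[OF o] unfolding is_factor_def by blast
  then have "ip {..<prow \<pi>} (\<lambda>x. X' x k) (\<lambda>x. X' x l) = 0"
    unfolding ip_def by (intro sum.neutral) auto
  then show ?thesis using False by auto
qed

lemma ortho_Row_orthonormal:
  assumes o: "ortho Row \<pi> \<pi>' X Y X' Y'" and k: "k < pcol \<pi>" and l: "l < pcol \<pi>"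
    and same: "\<And>y. supp \<pi>' k y \<Longrightarrow> supp \<pi>' l y \<Longrightarrow> Urank1 \<pi> \<pi>' k = Urank1 \<pi> \<pi>' l"
  shows "ip {..<pcol \<pi>'} (Y' k) (Y' l) = (if k = l then 1 else 0)"
proof (cases "Urank1 \<pi> \<pi>' k = Urank1 \<pi> \<pi>' l")
  case True
  obtain P where P: "P \<in> classes \<pi> \<pi>'" "k \<in> P" using k by (rule class_of)
  have lP: "l \<in> P" using classes_mem[OF P] l True by simp
  have "ip {..<pcol \<pi>'} (Y' k) (Y' l) = (\<Sum>y\<in>colsP \<pi> \<pi>' P. cnj (Y' k y) * Y' l y)"
    unfolding ip_def
  proof (rule sum.mono_neutral_right)
    have "Y' k y = 0" if y: "y \<notin> colsP \<pi> \<pi>' P" for y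
    proof (rule ccontr)
      assume "Y' k y \<noteq> 0"
      then obtain P' where P': "P' \<in> classes \<pi> \<pi>'" "k \<in> P'" "y \<in> colsP \<pi> \<pi>' P'"
        using o unfolding ortho_def block_supported_def by blast
      then show False using classes_disjoint[OF P(1) P'(1) P(2) P'(2)] y by blast
    qed
    then show "\<forall>y\<in>{..<pcol \<pi>'} - colsP \<pi> \<pi>' P. cnj (Y' k y) * Y' l y = 0" by simp
  qed (use colsP_subset in auto)
  also have "\<dots> = (if k = l then 1 else 0)" using o P(1) P(2) lP by (elim ortho_RowE)
  finally show ?thesis .
next
  case False
  have "Y' k y = 0 \<or> Y' l y = 0" for y
    using same[of y] False ortho_is_factor(2)[OF o] unfolding is_factor_def by blast
  then have "ip {..<pcol \<pi>'} (Y' k) (Y' l) = 0"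
    unfolding ip_def by (intro sum.neutral) auto
  then show ?thesis using False by auto
qed

section \<open>Interval patterns of a chainable architecture\<close>

text \<open>Cross-multiplying the equality of real quotients gives equality of the inner matrix
  sizes.\<close>

lemma chainable_size:
  assumes "valid_pattern \<pi>1" "valid_pattern \<pi>2"
  shows "chainable \<pi>1 \<pi>2 \<longleftrightarrow> pcol \<pi>1 = prow \<pi>2 \<and> pa \<pi>2 dvd pa \<pi>1 * pc \<pi>1 \<and> pa \<pi>1 dvd pa \<pi>2 \<and> pd \<pi>2 dvd pd \<pi>1"
proof -
  have "real (pa \<pi>1 * pc \<pi>1) / real (pa \<pi>2) = real (pb \<pi>2 * pd \<pi>2) / real (pd \<pi>1)
      \<longleftrightarrow> real (pa \<pi>1 * pc \<pi>1 * pd \<pi>1) = real (pa \<pi>2 * pb \<pi>2 * pd \<pi>2)"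
    using assms by (simp add: valid_pattern_def field_simps)
  then show ?thesis unfolding chainable_def prow_def pcol_def of_nat_eq_iff by blast
qed

lemma pstar_sel [simp]:
  "pa (pstar \<pi>1 \<pi>2) = pa \<pi>1" "pb (pstar \<pi>1 \<pi>2) = pb \<pi>1 * pd \<pi>1 div pd \<pi>2"
  "pc (pstar \<pi>1 \<pi>2) = pa \<pi>2 * pc \<pi>2 div pa \<pi>1" "pd (pstar \<pi>1 \<pi>2) = pd \<pi>2"
  by (simp_all add: pstar_def)

locale architecture =
  fixes \<beta> :: "nat \<Rightarrow> pattern" and L :: nat
  assumes arch: "is_arch \<beta> L" and chain: "chainable_arch \<beta> L"
begin

text \<open>\<open>N 0, ..., N L\<close> are the successive matrix dimensions along the product, so
  that a factor for the interval \<open>[p,q]\<close> has size \<open>N (p - 1)\<close> by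
  \<open>N q\<close>.\<close>

definition N :: "nat \<Rightarrow> nat" where
  "N j = (if j = 0 then prow (\<beta> 1) else pcol (\<beta> j))"

abbreviation a :: "nat \<Rightarrow> nat" where "a l \<equiv> pa (\<beta> l)"
abbreviation d :: "nat \<Rightarrow> nat" where "d l \<equiv> pd (\<beta> l)"

abbreviation sp :: "nat \<Rightarrow> nat \<Rightarrow> nat \<Rightarrow> nat \<Rightarrow> bool" where "sp p q \<equiv> supp (patI \<beta> p q)"

lemma L_pos: "1 \<le> L" using arch by (simp add: is_arch_def)

lemma pos:
  assumes "1 \<le> l" "l \<le> L"
  shows "0 < a l" "0 < pb (\<beta> l)" "0 < pc (\<beta> l)" "0 < d l"
  using arch assms by (auto simp: is_arch_def valid_pattern_def)

lemma prow_eq_N: "1 \<le> l \<Longrightarrow> l \<le> L \<Longrightarrow> prow (\<beta> l) = N (l - 1)"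
  using arch by (cases "l = 1") (auto simp: is_arch_def N_def pcol_def prow_def Ball_def dest!: spec[of _ "l - 1"])

lemma a_dvd:
  assumes "1 \<le> p" "p \<le> q" "q \<le> L"
  shows "a p dvd a q"
  using assms(2,3)
proof (induction q rule: dec_induct)
  case (step q)
  then have "a q dvd a (Suc q)" using chain assms(1) by (auto simp: chainable_arch_def chainable_def)
  then show ?case using step dvd_trans by (metis Suc_leD)
qed auto

lemma d_dvd:
  assumes "1 \<le> p" "p \<le> q" "q \<le> L"
  shows "d q dvd d p"
  using assms(2,3)
proof (induction q rule: dec_induct)
  case (step q)
  then have "d (Suc q) dvd d q" using chain assms(1) by (auto simp: chainable_arch_def chainable_def)
  then show ?case using step dvd_trans by (metis Suc_leD)
qed auto

text \<open>The boundary case \<open>p = Suc j\<close> is needed because an interval starting at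
  \<open>Suc j\<close> has \<open>N j\<close> rows; there the divisibility comes from the row count
  of \<open>\<beta> p\<close>.\<close>

lemma a_dvd_N:
  assumes "1 \<le> p" "p \<le> Suc j" "p \<le> L" "j \<le> L"
  shows "a p dvd N j"
proof (cases "p = Suc j")
  case True
  then have "N j = prow (\<beta> p)" using prow_eq_N[of p] assms by simp
  then show ?thesis by (simp add: prow_def mult.assoc)
next
  case False
  then have "a p dvd a j" using assms by (intro a_dvd) auto
  then show ?thesis using False assms by (auto simp: N_def pcol_def)
qed

lemma patI_eq:
  assumes "1 \<le> p" "p \<le> q" "q \<le> L"
  shows "patI \<beta> p q = (a p, pb (\<beta> p) * d p div d q, a q * pc (\<beta> q) div a p, d q)"
  using assms(2,3)
proof (induction q rule: dec_induct)
  case base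
  then show ?case using pos[of p] assms by (cases "\<beta> p") (simp add: patI_def)
next
  case (step q)
  have "patI \<beta> p (Suc q) = pstar (patI \<beta> p q) (\<beta> (Suc q))"
    using step.hyps by (simp add: patI_def)
  moreover have "d q dvd d p" using assms step by (intro d_dvd) auto
  then have "pb (\<beta> p) * d p div d q * d q = pb (\<beta> p) * d p" by simp
  ultimately show ?case using step by (simp add: pstar_def)
qed

lemma patI_same: "1 \<le> l \<Longrightarrow> l \<le> L \<Longrightarrow> patI \<beta> l l = \<beta> l"
  by (simp add: patI_def)

lemma patI_size:
  assumes "1 \<le> p" "p \<le> q" "q \<le> L"
  shows "prow (patI \<beta> p q) = N (p - 1)" "pcol (patI \<beta> p q) = N q"
    "pb (patI \<beta> p q) * pd (patI \<beta> p q) = N (p - 1) div a p"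
    "pc (patI \<beta> p q) * pd (patI \<beta> p q) = N q div a p"
proof -
  have "d q dvd d p" "a p dvd a q" using assms d_dvd a_dvd by auto
  then have b: "pb (\<beta> p) * d p div d q * d q = pb (\<beta> p) * d p"
    and c: "a p * (a q * pc (\<beta> q) div a p) = a q * pc (\<beta> q)" by simp_all
  have r: "N (p - 1) = a p * (pb (\<beta> p) * d p)" using prow_eq_N[of p] assms by (simp add: prow_def mult.assoc)
  have "N q = a q * pc (\<beta> q) * d q" using assms by (simp add: N_def pcol_def)
  then have s: "N q = a p * (a q * pc (\<beta> q) div a p * d q)" using c by (metis mult.assoc)
  show "prow (patI \<beta> p q) = N (p - 1)" "pcol (patI \<beta> p q) = N q"
    unfolding prow_def pcol_def patI_eq[OF assms] r s using b by (simp_all add: mult.assoc)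
  show "pb (patI \<beta> p q) * pd (patI \<beta> p q) = N (p - 1) div a p"
    "pc (patI \<beta> p q) * pd (patI \<beta> p q) = N q div a p"
    unfolding patI_eq[OF assms] r s using b pos[of p] assms by simp_all
qed

text \<open>The block number depends only on the left end \<open>p\<close> and the residue only on
  the right end \<open>q\<close>. All later support arguments reduce to coarsening one of these two
  invariants.\<close>

lemma sp_iff:
  assumes "1 \<le> p" "p \<le> q" "q \<le> L"
  shows "sp p q x y \<longleftrightarrow> x < N (p - 1) \<and> y < N q \<and>
    x div (N (p - 1) div a p) = y div (N q div a p) \<and> x mod d q = y mod d q"
proof -
  have pd: "pd (patI \<beta> p q) = d q" by (simp add: patI_eq[OF assms])
  show ?thesis unfolding supp_def patI_size[OF assms] unfolding pd ..
qed

text \<open>As \<open>a p\<close> divides \<open>a p'\<close>, each of the \<open>a p\<close> blocks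
  of an index range is a union of the same number of blocks for \<open>a p'\<close>, whatever the
  range. The bounds \<open>p' \<le> Suc j\<close> and \<open>p' \<le> Suc j'\<close> make the block
  lengths exact.\<close>

lemma div_coarsen:
  assumes "k div (N j div a p') = l div (N j' div a p')"
    and "1 \<le> p" "p \<le> p'" "p' \<le> L" "p' \<le> Suc j" "p' \<le> Suc j'" "j \<le> L" "j' \<le> L"
  shows "k div (N j div a p) = l div (N j' div a p)"
proof -
  obtain e where e: "a p' = a p * e" using a_dvd[of p p'] assms by (auto elim: dvdE)
  have pos': "0 < a p" "0 < a p'" using pos assms by auto
  have fac: "N i div a p = N i div a p' * e" if i: "p' \<le> Suc i" "i \<le> L" for i
  proof -
    obtain f where f: "N i = a p' * f" using a_dvd_N[of p' i] assms i by (auto elim: dvdE)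
    then have "N i = a p * (f * e)" by (simp add: e mult_ac)
    then have "N i div a p = f * e" using pos' by simp
    moreover have "N i div a p' = f" using f pos' by simp
    ultimately show ?thesis by simp
  qed
  show ?thesis using assms by (simp add: fac div_mult2_eq)
qed

lemma mod_coarsen:
  assumes "k mod d t = l mod d t" "1 \<le> t" "t \<le> t'" "t' \<le> L"
  shows "k mod d t' = l mod d t'"
  using d_dvd[of t t'] assms by (metis mod_mod_cancel)

text \<open>The common index \<open>k\<close> carries both invariants: its block number is coarsened
  from \<open>a (Suc q)\<close> to \<open>a p\<close>, and the residue it shares with
  \<open>x\<close> from \<open>d q\<close> to \<open>d t\<close>.\<close>

lemma sp_trans:
  assumes "sp p q x k" "sp (Suc q) t k y" "1 \<le> p" "p \<le> q" "q < t" "t \<le> L"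
  shows "sp p t x y"
proof -
  have "k div (N q div a p) = y div (N t div a p)"
    by (rule div_coarsen[of _ _ "Suc q"]) (use assms sp_iff[of "Suc q" t k y] in auto)
  moreover have "x mod d t = k mod d t"
    by (rule mod_coarsen[of _ q]) (use assms sp_iff[of p q x k] in auto)
  ultimately show ?thesis using assms sp_iff[of "Suc q" t k y] sp_iff[of p q x k] sp_iff[of p t x y] by auto
qed

lemma supported_mmul:
  assumes "supported (sp p q) X" "supported (sp (Suc q) t) Y" "1 \<le> p" "p \<le> q" "q < t" "t \<le> L"
  shows "supported (sp p t) (mmul k X Y)"
  unfolding supported_def
proof (intro allI impI)
  fix x y assume "mmul k X Y x y \<noteq> 0"
  then obtain l where "X x l \<noteq> 0" "Y l y \<noteq> 0" by (rule mmul_neq_0E)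
  then show "sp p t x y" using sp_trans assms unfolding supported_def by blast
qed

text \<open>All left patterns start at 1 and share their block number, so only residues get coarser
  to the right; all right patterns end at \<open>L\<close> and share their residue, so only block
  numbers get coarser to the left.\<close>

sublocale cut_family "N 0" "N L" L N "sp 1" "\<lambda>s. sp (Suc s) L"
proof
  fix s assume s: "s \<in> {1..<L}"
  show "fits (N 0) (N s) (sp 1 s)" "fits (N s) (N L) (sp (Suc s) L)"
    using s sp_iff[of 1 s] sp_iff[of "Suc s" L] by (auto simp: fits_def)
  fix s' assume s': "s' \<in> {1..<L}" and less: "s < s'"
  show "refines (sp 1 s) (sp 1 s')"
    unfolding refines_def
  proof (intro allI impI)
    fix x x' k k' assume h: "sp 1 s x k" "sp 1 s x' k" "sp 1 s' x k'"
    have "x' mod d s' = x mod d s'"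
      by (rule mod_coarsen[of _ s]) (use s s' less h sp_iff[of 1 s] in auto)
    then show "sp 1 s' x' k'" using s s' h sp_iff[of 1 s] sp_iff[of 1 s'] by auto
  qed
  show "refines (\<lambda>y k. sp (Suc s') L k y) (\<lambda>y k. sp (Suc s) L k y)"
    unfolding refines_def
  proof (intro allI impI)
    fix y y' k k' assume h: "sp (Suc s') L k y" "sp (Suc s') L k y'" "sp (Suc s) L k' y"
    have "y' div (N L div a (Suc s)) = y div (N L div a (Suc s))"
      by (rule div_coarsen[of _ _ "Suc s'"]) (use s s' less h sp_iff[of "Suc s'" L] in auto)
    then show "sp (Suc s) L k' y'" using s s' h sp_iff[of "Suc s'" L] sp_iff[of "Suc s" L] by auto
  qed
qed

section \<open>Orthonormality of interval factors\<close>

text \<open>Orthonormality is required among columns in the same block for \<open>a (Suc t)\<close>,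
  the ones that anything starting at \<open>Suc t\<close> can combine. The condition is independent
  of where the right neighbour ends, since the factor gets multiplied by the product of several
  intervals. The row version uses residues in the same way.\<close>

fun lorth :: "(nat \<times> nat) \<times> cmat \<Rightarrow> bool" where
  "lorth ((q, t), X) \<longleftrightarrow> (\<forall>k<N t. \<forall>l<N t. k div (N t div a (Suc t)) = l div (N t div a (Suc t)) \<longrightarrow>
     ip {..<N (q - 1)} (\<lambda>x. X x k) (\<lambda>x. X x l) = (if k = l then 1 else 0))"

fun rorth :: "(nat \<times> nat) \<times> cmat \<Rightarrow> bool" where
  "rorth ((q, t), X) \<longleftrightarrow> (\<forall>k<N (q - 1). \<forall>l<N (q - 1). k mod d (q - 1) = l mod d (q - 1) \<longrightarrow>
     ip {..<N t} (X k) (X l) = (if k = l then 1 else 0))"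

text \<open>Columns in one block for \<open>a (Suc q)\<close> that also meet in a row agree modulo
  \<open>d q\<close>. Both invariants then agree for the pair, on either side, so the columns lie in
  the same class.\<close>

lemma ortho_Column_lorth:
  assumes o: "ortho Column (patI \<beta> p q) (patI \<beta> (Suc q) t) X Y X' Y'"
    and b: "1 \<le> p" "p \<le> q" "q < t" "t \<le> L"
  shows "lorth ((p, q), X')"
  unfolding lorth.simps
proof (intro allI impI)
  fix k l assume k: "k < N q" and l: "l < N q"
    and eq: "k div (N q div a (Suc q)) = l div (N q div a (Suc q))"
  have div: "k div (N q div a p) = l div (N q div a p)"
    by (rule div_coarsen[OF eq]) (use b in auto)
  have "Urank1 (patI \<beta> p q) (patI \<beta> (Suc q) t) k = Urank1 (patI \<beta> p q) (patI \<beta> (Suc q) t) l"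
    if "sp p q x k" "sp p q x l" for x
  proof (rule Urank1_eqI)
    have m: "k mod d q = l mod d q" using that b sp_iff[of p q] by auto
    have "k mod d t = l mod d t" using m by (rule mod_coarsen) (use b in auto)
    then show "sp (Suc q) t k y \<longleftrightarrow> sp (Suc q) t l y" for y
      using b k l eq sp_iff[of "Suc q" t] by auto
    show "sp p q x k \<longleftrightarrow> sp p q x l" for x
      using b k l div m sp_iff[of p q] by auto
  qed
  then show "ip {..<N (p - 1)} (\<lambda>x. X' x k) (\<lambda>x. X' x l) = (if k = l then 1 else 0)"
    using ortho_Column_orthonormal[OF o, of k l] k l b patI_size[of p q] by auto
qed

lemma ortho_Row_rorth:
  assumes o: "ortho Row (patI \<beta> p q) (patI \<beta> (Suc q) t) X Y X' Y'"
    and b: "1 \<le> p" "p \<le> q" "q < t" "t \<le> L"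
  shows "rorth ((Suc q, t), Y')"
  unfolding rorth.simps diff_Suc_1
proof (intro allI impI)
  fix k l assume k: "k < N q" and l: "l < N q" and m: "k mod d q = l mod d q"
  have m': "k mod d t = l mod d t" using m by (rule mod_coarsen) (use b in auto)
  have "Urank1 (patI \<beta> p q) (patI \<beta> (Suc q) t) k = Urank1 (patI \<beta> p q) (patI \<beta> (Suc q) t) l"
    if "sp (Suc q) t k y" "sp (Suc q) t l y" for y
  proof (rule Urank1_eqI)
    have eq: "k div (N q div a (Suc q)) = l div (N q div a (Suc q))"
      using that b sp_iff[of "Suc q" t] by auto
    have "k div (N q div a p) = l div (N q div a p)"
      by (rule div_coarsen[OF eq]) (use b in auto)
    then show "sp p q x k \<longleftrightarrow> sp p q x l" for x
      using b k l m sp_iff[of p q] by auto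
    show "sp (Suc q) t k y \<longleftrightarrow> sp (Suc q) t l y" for y
      using b k l eq m' sp_iff[of "Suc q" t] by auto
  qed
  then show "ip {..<N t} (Y' k) (Y' l) = (if k = l then 1 else 0)"
    using ortho_Row_orthonormal[OF o, of k l] k l b patI_size[of p q] patI_size[of "Suc q" t] by auto
qed

lemma extend_left:
  assumes best: "best_approx (N e) (N t) M M' (cutset (N s) (sp (Suc e) s) (sp (Suc s) t))"
    and M: "supported (sp (Suc e) t) M" and X: "supported (sp p e) X" and o: "lorth ((p, e), X)"
    and b: "1 \<le> p" "p \<le> e" "e < s" "s < t" "t \<le> L"
  shows "best_approx (N (p - 1)) (N t) (mmul (N e) X M) (mmul (N e) X M') (cutset (N s) (sp p s) (sp (Suc s) t))"
proof (rule best_approx_extend_left[OF best _ _ M X])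
  fix y k k' assume h: "sp (Suc e) t k y" "sp (Suc e) t k' y"
  then have "k < N e" "k' < N e" "k div (N e div a (Suc e)) = k' div (N e div a (Suc e))"
    using b sp_iff[of "Suc e" t] by auto
  then show "ip {..<N (p - 1)} (\<lambda>x. X x k) (\<lambda>x. X x k') = (if k = k' then 1 else 0)"
    using o by auto
next
  show "k < N e" if "sp (Suc e) t k y" for k y using that b sp_iff[of "Suc e" t] by auto
  show "sp (Suc e) t k y" if "sp (Suc e) s k l" "sp (Suc s) t l y" for k l y
    by (rule sp_trans[OF that]) (use b in auto)
  show "sp p s x l" if "sp p e x k" "sp (Suc e) s k l" for x k l
    by (rule sp_trans[OF that]) (use b in auto)
next
  fix x k l y assume h: "sp (Suc e) t k y" "sp (Suc s) t l y" "sp p e x k" "sp p s x l"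
  \<comment> \<open>Cancellation: the fine block number of \<open>k\<close> and \<open>l\<close> is
    compared through the column \<open>y\<close> that both reach, their residue through the row
    \<open>x\<close>.\<close>
  have "l div (N s div a (Suc e)) = y div (N t div a (Suc e))"
    by (rule div_coarsen[of _ _ "Suc s"]) (use b h sp_iff[of "Suc s" t] in auto)
  moreover have "x mod d s = k mod d s"
    by (rule mod_coarsen[of _ e]) (use b h sp_iff[of p e] in auto)
  ultimately show "sp (Suc e) s k l"
    using b h sp_iff[of "Suc e" s k l] sp_iff[of "Suc e" t k y] sp_iff[of "Suc s" t l y] sp_iff[of p s x l] by auto
qed

lemma extend_right:
  assumes best: "best_approx (N (p - 1)) (N t) M M' (cutset (N s) (sp p s) (sp (Suc s) t))"
    and M: "supported (sp p t) M" and X: "supported (sp (Suc t) e) X" and o: "rorth ((Suc t, e), X)"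
    and b: "1 \<le> p" "p \<le> s" "s < t" "t < e" "e \<le> L"
  shows "best_approx (N (p - 1)) (N e) (mmul (N t) M X) (mmul (N t) M' X) (cutset (N s) (sp p s) (sp (Suc s) e))"
proof (rule best_approx_extend_right[OF best _ _ M X])
  fix x k k' assume h: "sp p t x k" "sp p t x k'"
  then have "k < N t" "k' < N t" "k mod d t = k' mod d t"
    using b sp_iff[of p t] by auto
  then show "ip {..<N e} (X k) (X k') = (if k = k' then 1 else 0)"
    using o by auto
next
  show "k < N t" if "sp p t x k" for x k using that b sp_iff[of p t] by auto
  show "sp p t x k" if "sp p s x l" "sp (Suc s) t l k" for x l k
    by (rule sp_trans[OF that]) (use b in auto)
  show "sp (Suc s) e l y" if "sp (Suc s) t l k" "sp (Suc t) e k y" for l k y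
    by (rule sp_trans[OF that]) (use b in auto)
next
  fix x l k y assume h: "sp p t x k" "sp p s x l" "sp (Suc t) e k y" "sp (Suc s) e l y"
  have "k div (N t div a (Suc s)) = y div (N e div a (Suc s))"
    by (rule div_coarsen[of _ _ "Suc t"]) (use b h sp_iff[of "Suc t" e] in auto)
  moreover have "x mod d t = l mod d t"
    by (rule mod_coarsen[of _ s]) (use b h sp_iff[of p s] in auto)
  ultimately show "sp (Suc s) t l k"
    using b h sp_iff[of "Suc s" t l k] sp_iff[of p t x k] sp_iff[of "Suc t" e k y] sp_iff[of "Suc s" e l y] by auto
qed

end

section \<open>States of the butterfly algorithm\<close>

fun tiles :: "nat \<Rightarrow> nat \<Rightarrow> (nat \<times> nat) list \<Rightarrow> bool" where
  "tiles p t [] \<longleftrightarrow> p = Suc t"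
| "tiles p t (I # Is) \<longleftrightarrow> fst I = p \<and> p \<le> snd I \<and> tiles (Suc (snd I)) t Is"

lemma tiles_le: "tiles p t Is \<Longrightarrow> p \<le> Suc t"
  by (induction Is arbitrary: p) fastforce+

text \<open>Positivity of \<open>p\<close> lets an empty prefix end at \<open>p - 1\<close>.\<close>

lemma tiles_append:
  "1 \<le> p \<Longrightarrow> tiles p t (Is @ Js) \<longleftrightarrow> (\<exists>s. p \<le> Suc s \<and> tiles p s Is \<and> tiles (Suc s) t Js)"
proof (induction Is arbitrary: p)
  case Nil
  then show ?case by (auto intro: exI[of _ "p - 1"])
next
  case (Cons I Is)
  show ?case
  proof (cases "fst I = p \<and> p \<le> snd I")
    case True
    then have "tiles p t ((I # Is) @ Js) \<longleftrightarrow> (\<exists>s. Suc (snd I) \<le> Suc s \<and> tiles (Suc (snd I)) s Is \<and> tiles (Suc s) t Js)"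
      using Cons.IH[of "Suc (snd I)"] by simp
    also have "\<dots> \<longleftrightarrow> (\<exists>s. p \<le> Suc s \<and> tiles p s (I # Is) \<and> tiles (Suc s) t Js)"
      using True tiles_le by fastforce
    finally show ?thesis .
  qed auto
qed

context architecture
begin

definition factored :: "bstate \<Rightarrow> bool" where
  "factored xs \<longleftrightarrow> (\<forall>x\<in>set xs. is_factor (pI \<beta> (fst x)) (snd x))"

text \<open>\<open>rmul\<close> takes each inner dimension from the left end of the factor being
  appended, \<open>lmul\<close> from the right end of the factor being prepended. Both bracketings
  are needed, as a local best approximation is extended first to the left and then to the
  right.\<close>

fun rmul :: "cmat \<Rightarrow> bstate \<Rightarrow> cmat" where
  "rmul W [] = W"
| "rmul W (x # xs) = rmul (mmul (N (fst (fst x) - 1)) W (snd x)) xs"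

fun lmul :: "bstate \<Rightarrow> cmat \<Rightarrow> cmat" where
  "lmul [] W = W"
| "lmul (x # xs) W = mmul (N (snd (fst x))) (snd x) (lmul xs W)"

definition sprod :: "bstate \<Rightarrow> cmat" where
  "sprod xs = rmul (snd (hd xs)) (tl xs)"

lemma sprod_Cons: "sprod (x # xs) = rmul (snd x) xs"
  by (simp add: sprod_def)

lemma rmul_append: "rmul W (xs @ ys) = rmul (rmul W xs) ys"
  by (induction xs arbitrary: W) auto

lemma rmul_mmul: "rmul (mmul k X W) xs = mmul k X (rmul W xs)"
  by (induction xs arbitrary: W) (auto simp: mmul_assoc)

lemma lmul_mmul: "mmul k (lmul xs W) X = lmul xs (mmul k W X)"
  by (induction xs) (auto simp: mmul_assoc)

lemma sprod_append: "us \<noteq> [] \<Longrightarrow> sprod (us @ vs) = rmul (sprod us) vs"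
  by (cases us) (auto simp: sprod_Cons rmul_append)

lemma rmul_sprod: "vs \<noteq> [] \<Longrightarrow> rmul W vs = mmul (N (fst (fst (hd vs)) - 1)) W (sprod vs)"
  by (cases vs) (auto simp: sprod_Cons rmul_mmul)

text \<open>The inner dimensions used by the two bracketings agree because consecutive intervals are
  adjacent.\<close>

lemma sprod_lmul:
  assumes "tiles p e (map fst us)" "fst (fst x) = Suc e"
  shows "sprod (us @ [x]) = lmul us (snd x)"
  using assms(1)
proof (induction us arbitrary: p)
  case Nil
  then show ?case by (simp add: sprod_Cons)
next
  case (Cons u us)
  have "fst (fst (hd (us @ [x]))) = Suc (snd (fst u))"
    using Cons.prems assms(2) by (cases us) auto
  then have "sprod ((u # us) @ [x]) = mmul (N (snd (fst u))) (snd u) (sprod (us @ [x]))"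
    using rmul_sprod[of "us @ [x]" "snd u"] by (simp add: sprod_Cons)
  moreover have "sprod (us @ [x]) = lmul us (snd x)"
    using Cons.prems by (intro Cons.IH) auto
  ultimately show ?case by simp
qed

lemma lmul_supported:
  assumes "tiles p e (map fst us)" "1 \<le> p" "e < t" "t \<le> L" "factored us" "supported (sp (Suc e) t) M"
  shows "supported (sp p t) (lmul us M)"
  using assms(1,2,5)
proof (induction us arbitrary: p)
  case Nil
  then show ?case using assms by simp
next
  case (Cons u us)
  obtain q X where u: "u = ((p, q), X)" using Cons.prems by (cases u) auto
  have q: "p \<le> q" "tiles (Suc q) e (map fst us)" using Cons.prems u by auto
  have "q \<le> e" using tiles_le[OF q(2)] by simp
  have "supported (sp (Suc q) t) (lmul us M)"
    using Cons.IH[OF q(2)] Cons.prems by (simp add: factored_def)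
  moreover have "supported (sp p q) X"
    using Cons.prems by (simp add: u factored_def is_factor_eq_supported)
  ultimately show ?case
    using supported_mmul[of p q X t] \<open>q \<le> e\<close> q Cons.prems assms by (simp add: u)
qed

lemma sprod_supported:
  assumes "tiles p t (map fst xs)" "1 \<le> p" "t \<le> L" "xs \<noteq> []" "factored xs"
  shows "supported (sp p t) (sprod xs)"
proof -
  obtain us x where xs: "xs = us @ [x]" using assms(4) by (metis rev_exhaust)
  obtain q t' X where x: "x = ((q, t'), X)" by (metis surj_pair)
  obtain e where e: "p \<le> Suc e" "tiles p e (map fst us)" "q = Suc e" "Suc e \<le> t'" "t' = t"
    using assms(1) tiles_append[OF assms(2), of t "map fst us" "[(q, t')]"] by (auto simp: xs x)
  have "supported (sp q t) X" using assms(5) e by (simp add: xs x factored_def is_factor_eq_supported)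
  moreover have "factored us" using assms(5) by (simp add: xs factored_def)
  ultimately have "supported (sp p t) (lmul us X)"
    using lmul_supported[OF e(2) assms(2), of t X] e assms(3) by simp
  then show ?thesis using sprod_lmul[OF e(2), of x] e by (simp add: xs x)
qed

lemma extend_left_list:
  assumes "tiles p e (map fst us)" "1 \<le> p" "factored us" "\<forall>u\<in>set us. lorth u"
    and "best_approx (N e) (N t) M M' (cutset (N s) (sp (Suc e) s) (sp (Suc s) t))"
    and "supported (sp (Suc e) t) M" "us \<noteq> [] \<longrightarrow> e < s" "s < t" "t \<le> L"
  shows "best_approx (N (p - 1)) (N t) (lmul us M) (lmul us M') (cutset (N s) (sp p s) (sp (Suc s) t))"
  using assms(1-4,7)
proof (induction us arbitrary: p)
  case Nil
  then show ?case using assms by simp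
next
  case (Cons u us)
  obtain q X where u: "u = ((p, q), X)" using Cons.prems by (cases u) auto
  have q: "p \<le> q" "tiles (Suc q) e (map fst us)" using Cons.prems u by auto
  have "q \<le> e" using tiles_le[OF q(2)] by simp
  have us: "factored us" using Cons.prems by (simp add: factored_def)
  have b: "best_approx (N q) (N t) (lmul us M) (lmul us M') (cutset (N s) (sp (Suc q) s) (sp (Suc s) t))"
    using Cons.IH[OF q(2)] Cons.prems us by simp
  moreover have "supported (sp (Suc q) t) (lmul us M)"
    using lmul_supported[OF q(2) _ _ _ us] Cons.prems assms by simp
  moreover have "supported (sp p q) X"
    using Cons.prems by (simp add: u factored_def is_factor_eq_supported)
  moreover have "lorth ((p, q), X)" using Cons.prems by (simp add: u)
  ultimately show ?case
    using extend_left[of q t "lmul us M" "lmul us M'" s p X] \<open>q \<le> e\<close> q Cons.prems assms by (simp add: u)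
qed

lemma extend_right_list:
  assumes "tiles (Suc t) e (map fst vs)" "e \<le> L" "factored vs" "\<forall>v\<in>set vs. rorth v"
    and "best_approx (N (p - 1)) (N t) M M' (cutset (N s) (sp p s) (sp (Suc s) t))"
    and "vs \<noteq> [] \<longrightarrow> supported (sp p t) M" and b: "1 \<le> p" "p \<le> s" and "s < t"
  shows "best_approx (N (p - 1)) (N e) (rmul M vs) (rmul M' vs) (cutset (N s) (sp p s) (sp (Suc s) e))"
  using assms(1-6,9)
proof (induction vs arbitrary: t M M')
  case Nil
  then show ?case by simp
next
  case (Cons v vs)
  obtain q X where v: "v = ((Suc t, q), X)" using Cons.prems by (cases v) auto
  have q: "t < q" "tiles (Suc q) e (map fst vs)" using Cons.prems v by auto
  have "q \<le> e" using tiles_le[OF q(2)] by simp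
  have X: "supported (sp (Suc t) q) X"
    using Cons.prems by (simp add: v factored_def is_factor_eq_supported)
  have "best_approx (N (p - 1)) (N q) (mmul (N t) M X) (mmul (N t) M' X) (cutset (N s) (sp p s) (sp (Suc s) q))"
    using Cons.prems X b q \<open>q \<le> e\<close> by (intro extend_right) (auto simp: v)
  moreover have "supported (sp p q) (mmul (N t) M X)"
    using Cons.prems X b q \<open>q \<le> e\<close> by (intro supported_mmul) auto
  ultimately show ?case
    using Cons.IH[OF q(2), of "mmul (N t) M X" "mmul (N t) M' X"] Cons.prems q by (simp add: v factored_def)
qed

lemma ortho_update:
  assumes tl: "tiles 1 L (map fst xs)" and f: "factored xs" and k: "Suc k < length xs"
    and o: "ortho u (pI \<beta> (fst (xs ! k))) (pI \<beta> (fst (xs ! Suc k))) (snd (xs ! k)) (snd (xs ! Suc k)) X' Y'"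
    and ys: "ys = xs[k := (fst (xs ! k), X'), Suc k := (fst (xs ! Suc k), Y')]"
  shows "map fst ys = map fst xs" "factored ys" "sprod ys = sprod xs"
    "u = Column \<Longrightarrow> lorth (ys ! k)" "u = Row \<Longrightarrow> rorth (ys ! Suc k)"
proof -
  define us vs where "us = take k xs" and "vs = drop (Suc (Suc k)) xs"
  have len: "length us = k" using k by (simp add: us_def)
  obtain p q X where xk: "xs ! k = ((p, q), X)" by (metis surj_pair)
  obtain p' t Y where xk': "xs ! Suc k = ((p', t), Y)" by (metis surj_pair)
  have xs: "xs = us @ ((p, q), X) # ((p', t), Y) # vs"
    using k by (simp add: us_def vs_def Cons_nth_drop_Suc flip: xk xk')
  obtain e where e: "1 \<le> Suc e" "tiles 1 e (map fst us)" "tiles (Suc e) L ((p, q) # (p', t) # map fst vs)"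
    using tl tiles_append[of 1 L "map fst us" "(p, q) # (p', t) # map fst vs"] by (auto simp: xs)
  have b: "1 \<le> p" "p \<le> q" "p' = Suc q" "q < t" "t \<le> L" "p = Suc e"
    using e tiles_le[of "Suc t" L "map fst vs"] by auto
  have ys': "ys = us @ ((p, q), X') # ((Suc q, t), Y') # vs"
    unfolding ys xk xk' using len b by (simp add: xs list_update_append nth_append)
  have o': "ortho u (patI \<beta> p q) (patI \<beta> (Suc q) t) X Y X' Y'" using o by (simp add: xk xk' b)
  show "map fst ys = map fst xs" by (simp add: ys' xs b)
  show "factored ys" using f ortho_is_factor[OF o'] by (auto simp: ys' xs factored_def b)
  have "mmul (pcol (patI \<beta> p q)) X' Y' = mmul (pcol (patI \<beta> p q)) X Y"
    using o' f by (intro ortho_product) (auto simp: xs factored_def b)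
  then have "mmul (N q) X' Y' = mmul (N q) X Y" using patI_size[of p q] b by simp
  moreover have "mmul k (mmul l W X') Y' = mmul k (mmul l W X) Y" if "mmul k X' Y' = mmul k X Y" for k l W
    using that by (simp add: mmul_assoc)
  ultimately show "sprod ys = sprod xs"
    by (cases us) (auto simp: ys' xs b sprod_Cons rmul_append)
  show "lorth (ys ! k)" if "u = Column"
    using ortho_Column_lorth[of p q t X Y X' Y'] o' that b len by (simp add: ys' nth_append del: lorth.simps)
  show "rorth (ys ! Suc k)" if "u = Row"
    using ortho_Row_rorth[of p q t X Y X' Y'] o' that b len by (simp add: ys' nth_append del: rorth.simps)
qed

text \<open>Step \<open>k\<close> changes only positions \<open>k\<close> and \<open>Suc k\<close>:
  the former is final, and the latter is treated next if it lies before \<open>j\<close>.\<close>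

lemma colsweep_invariant:
  assumes "colsweep \<beta> k j xs ys" "tiles 1 L (map fst xs)" "factored xs" "k \<le> j" "\<forall>i<k. lorth (xs ! i)"
  shows "map fst ys = map fst xs \<and> factored ys \<and> sprod ys = sprod xs \<and> (\<forall>i<j. lorth (ys ! i))"
  using assms
proof (induction rule: colsweep.induct)
  case (1 k j xs)
  then show ?case by auto
next
  case (2 k j xs X' Y' ys)
  let ?zs = "xs[k := (fst (xs ! k), X'), Suc k := (fst (xs ! Suc k), Y')]"
  note hyps = "2.hyps" and IH = "2.IH" and prems = "2.prems"
  note o = ortho_update[OF prems(1,2) hyps(2,3) refl]
  have "\<forall>i<Suc k. lorth (?zs ! i)" using o(4) prems(4) by (auto simp: less_Suc_eq simp del: lorth.simps)
  moreover have "Suc k \<le> j" using hyps(1) by simp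
  ultimately show ?case using IH o(1-3) prems(1) by simp
qed

text \<open>The last conclusion holds because positions before \<open>j\<close> are never touched;
  it preserves what the preceding column sweep achieved.\<close>

lemma rowsweep_invariant:
  assumes "rowsweep \<beta> k j xs ys" "tiles 1 L (map fst xs)" "factored xs" "j \<le> k"
    "\<forall>i. k < i \<and> i < length xs \<longrightarrow> rorth (xs ! i)"
  shows "map fst ys = map fst xs \<and> factored ys \<and> sprod ys = sprod xs \<and>
    (\<forall>i. j < i \<and> i < length xs \<longrightarrow> rorth (ys ! i)) \<and> (\<forall>i<j. ys ! i = xs ! i)"
  using assms
proof (induction rule: rowsweep.induct)
  case (1 j k xs)
  then show ?case by auto
next
  case (2 j k xs X' Y' ys)
  note hyps = "2.hyps" and IH = "2.IH" and prems = "2.prems"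
  obtain k' where k: "k = Suc k'" using hyps(1) by (cases k) auto
  let ?zs = "xs[k - 1 := (fst (xs ! (k - 1)), X'), k := (fst (xs ! k), Y')]"
  have o: "map fst ?zs = map fst xs" "factored ?zs" "sprod ?zs = sprod xs" "rorth (?zs ! k)"
    using ortho_update[of xs k' Row X' Y' ?zs] hyps prems by (simp_all add: k)
  have "\<forall>i. k - 1 < i \<and> i < length ?zs \<longrightarrow> rorth (?zs ! i)"
  proof (intro allI impI)
    fix i assume i: "k - 1 < i \<and> i < length ?zs"
    show "rorth (?zs ! i)"
    proof (cases "i = k")
      case False
      then show ?thesis using i prems(4) k by simp
    qed (use o(4) in simp)
  qed
  then have "map fst ys = map fst ?zs \<and> factored ys \<and> sprod ys = sprod ?zs \<and>
    (\<forall>i. j < i \<and> i < length ?zs \<longrightarrow> rorth (ys ! i)) \<and> (\<forall>i<j. ys ! i = ?zs ! i)"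
    using hyps(1) prems(1) o(1,2) by (intro IH) auto
  then show ?case using o hyps(1) by auto
qed

end

section \<open>Error bounds\<close>

context architecture
begin

text \<open>The block-optimal split is a best approximation within the interval; the orthonormal
  neighbours extend it to the whole product. The disjunction in \<open>f\<close> covers the initial
  state, where \<open>A\<close> is an arbitrary matrix without neighbours.\<close>

lemma split_best_approx:
  assumes xs: "xs = us @ ((q, t), M) # vs" and tl: "tiles 1 L (map fst xs)"
    and ys: "ys = us @ ((q, s), X) # ((Suc s, t), Y) # vs"
    and s: "q \<le> s" "s < t"
    and f: "factored xs \<or> us = [] \<and> vs = []"
    and us: "\<forall>u\<in>set us. lorth u" and vs: "\<forall>v\<in>set vs. rorth v"
    and tf: "twofactor M (patI \<beta> q s) (patI \<beta> (Suc s) t) X Y"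
  shows "tiles 1 L (map fst ys)" "factored ys" "best_approx (N 0) (N L) (sprod xs) (sprod ys) (cut s)"
    "1 \<le> s" "s < L"
proof -
  obtain e where e: "tiles 1 e (map fst us)" "tiles (Suc e) L ((q, t) # map fst vs)"
    using tl tiles_append[of 1 L "map fst us" "(q, t) # map fst vs"] by (auto simp: xs)
  have q: "q = Suc e" and tvs: "tiles (Suc t) L (map fst vs)" using e by auto
  have tL: "t \<le> L" using tiles_le[OF tvs] by simp
  show "1 \<le> s" "s < L" using s q tL by auto
  have "tiles (Suc e) L ((q, s) # (Suc s, t) # map fst vs)" using e(2) s by simp
  then show "tiles 1 L (map fst ys)"
    using e(1) tiles_append[of 1 L "map fst us" "(q, s) # (Suc s, t) # map fst vs"] by (auto simp: ys)
  have XY: "is_factor (patI \<beta> q s) X" "is_factor (patI \<beta> (Suc s) t) Y"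
    using tf is_factor_if_block_supported unfolding twofactor_def by blast+
  have fus: "factored us" and fvs: "factored vs" using f by (auto simp: xs factored_def)
  then show "factored ys" using XY by (auto simp: ys factored_def)
  have M: "supported (sp (Suc e) t) M" if "us \<noteq> [] \<or> vs \<noteq> []"
    using f that by (auto simp: xs q factored_def is_factor_eq_supported)
  let ?M' = "mmul (N s) X Y"
  have "best_approx (N (q - 1)) (N t) M ?M' (cutset (N s) (sp q s) (sp (Suc s) t))"
    using twofactor_best_approx[OF tf] patI_size[of q s] patI_size[of "Suc s" t] s q tL by simp
  then have best: "best_approx (N e) (N t) M ?M' (cutset (N s) (sp (Suc e) s) (sp (Suc s) t))"
    by (simp add: q)
  have bl: "best_approx (N 0) (N t) (lmul us M) (lmul us ?M') (cutset (N s) (sp 1 s) (sp (Suc s) t))"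
  proof (cases "us = []")
    case True
    then show ?thesis using best e(1) by simp
  next
    case False
    then show ?thesis
      using extend_left_list[OF e(1) _ fus us best] M s q tL by simp
  qed
  have "best_approx (N (1 - 1)) (N L) (rmul (lmul us M) vs) (rmul (lmul us ?M') vs) (cut s)"
  proof (rule extend_right_list[OF tvs _ fvs vs])
    show "vs \<noteq> [] \<longrightarrow> supported (sp 1 t) (lmul us M)"
      using lmul_supported[OF e(1) _ _ tL fus M] s q by simp
  qed (use bl s q in auto)
  moreover have "sprod xs = rmul (lmul us M) vs"
    using sprod_append[of "us @ [((q, t), M)]" vs] sprod_lmul[OF e(1), of "((q, t), M)"] by (simp add: xs q)
  moreover have "sprod ys = rmul (lmul us ?M') vs"
    using sprod_append[of "us @ [((q, s), X)]" "((Suc s, t), Y) # vs"] sprod_lmul[OF e(1), of "((q, s), X)"]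
    by (simp add: ys q lmul_mmul)
  ultimately show "best_approx (N 0) (N L) (sprod xs) (sprod ys) (cut s)" by simp
qed

text \<open>Right ends of intervals record the cuts already made. A cut not among them lies strictly
  before the end of its interval, so both halves of the split are nonempty.\<close>

lemma bf_step_best_approx:
  assumes st: "bf_step \<beta> s xs ys" and tl: "tiles 1 L (map fst xs)"
    and f: "factored xs \<or> length xs = 1" and ends: "s \<notin> snd ` set (map fst xs)"
  shows "tiles 1 L (map fst ys)" "factored ys" "best_approx (N 0) (N L) (sprod xs) (sprod ys) (cut s)"
    "snd ` set (map fst ys) \<subseteq> insert s (snd ` set (map fst xs))"
proof -
  obtain j q t xs1 xs2 X Y where j: "j < length xs" "fst (xs ! j) = (q, t)" "q \<le> s" "s \<le> t"
    and sw: "colsweep \<beta> 0 j xs xs1" "rowsweep \<beta> (length xs - 1) j xs1 xs2"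
    and tf: "twofactor (snd (xs2 ! j)) (patI \<beta> q s) (patI \<beta> (Suc s) t) X Y"
    and ys: "ys = take j xs2 @ [((q, s), X), ((Suc s, t), Y)] @ drop (Suc j) xs2"
    using st unfolding bf_step_def by blast
  have "(q, t) \<in> set (map fst xs)" using j(1,2) by (metis length_map nth_map nth_mem)
  then have "s \<noteq> t" using ends by force
  then have st: "s < t" using j(4) by simp
  have xs2: "map fst xs2 = map fst xs \<and> (factored xs2 \<or> length xs = 1) \<and> sprod xs2 = sprod xs \<and>
    (\<forall>i<j. lorth (xs2 ! i)) \<and> (\<forall>i. j < i \<and> i < length xs \<longrightarrow> rorth (xs2 ! i))"
  proof (cases "length xs = 1")
    \<comment> \<open>With a single interval both sweeps are empty, so the unfactored initial matrix
      is left unchanged.\<close>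
    case True
    then have "j = 0" using j(1) by simp
    then have "xs1 = xs" using sw(1) by (auto elim: colsweep.cases)
    then have "xs2 = xs" using sw(2) True \<open>j = 0\<close> by (auto elim: rowsweep.cases)
    then show ?thesis using True \<open>j = 0\<close> by simp
  next
    case False
    then have "factored xs" using f by simp
    then have 1: "map fst xs1 = map fst xs" "factored xs1" "sprod xs1 = sprod xs" "\<forall>i<j. lorth (xs1 ! i)"
      using colsweep_invariant[OF sw(1) tl] by auto
    have len: "length xs1 = length xs" using 1(1) by (metis length_map)
    have "map fst xs2 = map fst xs1 \<and> factored xs2 \<and> sprod xs2 = sprod xs1 \<and>
      (\<forall>i. j < i \<and> i < length xs1 \<longrightarrow> rorth (xs2 ! i)) \<and> (\<forall>i<j. xs2 ! i = xs1 ! i)"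
      using sw(2) tl 1 j(1) len by (intro rowsweep_invariant) auto
    then show ?thesis using 1 len by auto
  qed
  have len: "length xs2 = length xs" using xs2 by (metis length_map)
  define us vs M where "us = take j xs2" and "vs = drop (Suc j) xs2" and "M = snd (xs2 ! j)"
  have "fst (xs2 ! j) = (q, t)" using xs2 j len by (metis nth_map)
  then have split: "xs2 = us @ ((q, t), M) # vs"
    using j(1) len id_take_nth_drop[of j xs2] by (metis M_def prod.collapse us_def vs_def)
  have us: "\<forall>u\<in>set us. lorth u"
  proof
    fix u assume "u \<in> set us"
    then obtain i where "i < j" "u = xs2 ! i" using j(1) len by (auto simp: us_def in_set_conv_nth)
    then show "lorth u" using xs2 by blast
  qed
  have vs: "\<forall>v\<in>set vs. rorth v"
  proof
    fix v assume "v \<in> set vs"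
    then obtain i where "i < length xs - Suc j" "v = xs2 ! (Suc j + i)"
      using j(1) len by (auto simp: vs_def in_set_conv_nth)
    moreover from this have "j < Suc j + i \<and> Suc j + i < length xs" by simp
    ultimately show "rorth v" using xs2 by blast
  qed
  have ys': "ys = us @ ((q, s), X) # ((Suc s, t), Y) # vs" by (simp add: ys us_def vs_def)
  have tl2: "tiles 1 L (map fst xs2)" using tl xs2 by simp
  have f2: "factored xs2 \<or> us = [] \<and> vs = []"
    using xs2 len split by (cases "length xs = 1") auto
  note * = split_best_approx[OF split tl2 ys' j(3) st f2 us vs tf[folded M_def]]
  show "tiles 1 L (map fst ys)" "factored ys" by (fact *)+
  show "best_approx (N 0) (N L) (sprod xs) (sprod ys) (cut s)" using *(3) xs2 by simp
  have "snd ` set (map fst ys) \<subseteq> insert s (snd ` set (map fst xs2))"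
    by (auto simp: ys' split)
  then show "snd ` set (map fst ys) \<subseteq> insert s (snd ` set (map fst xs))" using xs2 by simp
qed

text \<open>Turns a run into the abstract sequence used by the error bounds. Injectivity of
  \<open>\<sigma>\<close> makes each cut new, and \<open>\<sigma> J < L\<close> separates it from
  the outer end \<open>L\<close>.\<close>

lemma bf_iter_best_approx:
  assumes "bf_iter \<beta> \<sigma> L J xs zs" and "inj_on \<sigma> {1..<L}" "\<sigma> ` {1..<L} \<subseteq> {1..<L}"
    and "1 \<le> J" "J \<le> L" "tiles 1 L (map fst xs)" "factored xs \<or> length xs = 1"
    and "snd ` set (map fst xs) \<subseteq> insert L (\<sigma> ` {1..<J})"
  shows "\<exists>B. B J = sprod xs \<and> B L = sprod zs \<and>
    (\<forall>i\<in>{J..<L}. best_approx (N 0) (N L) (B i) (B (Suc i)) (cut (\<sigma> i)))"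
  using assms(1,4-)
proof (induction rule: bf_iter.induct)
  case (1 J xs)
  then show ?case by (intro exI[of _ "\<lambda>_. sprod xs"]) simp
next
  case (2 J xs ys zs)
  note hyps = "2.hyps" and IH = "2.IH" and prems = "2.prems"
  have J: "J \<in> {1..<L}" using hyps prems by simp
  then have "\<sigma> J \<in> {1..<L}" using assms(3) by blast
  moreover have "\<sigma> J \<notin> \<sigma> ` {1..<J}"
  proof
    assume "\<sigma> J \<in> \<sigma> ` {1..<J}"
    then obtain i where i: "i \<in> {1..<J}" "\<sigma> J = \<sigma> i" by blast
    then have "J = i" using inj_onD[OF assms(2), of J i] J by simp
    then show False using i(1) by simp
  qed
  ultimately have "\<sigma> J \<notin> snd ` set (map fst xs)" using prems(5) by auto
  note step = bf_step_best_approx[OF hyps(2) prems(3,4) this]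
  have "insert (\<sigma> J) (\<sigma> ` {1..<J}) = \<sigma> ` {1..<Suc J}" using prems(1) by (simp add: atLeastLessThanSuc)
  then have "snd ` set (map fst ys) \<subseteq> insert L (\<sigma> ` {1..<Suc J})" using step(4) prems(5) by blast
  then obtain B where B: "B (Suc J) = sprod ys" "B L = sprod zs"
    "\<forall>i\<in>{Suc J..<L}. best_approx (N 0) (N L) (B i) (B (Suc i)) (cut (\<sigma> i))"
    using IH step(1,2) hyps(1) by auto
  \<comment> \<open>The sequence is built backwards: the tail comes from the induction hypothesis,
    and the current product is inserted at \<open>J\<close>.\<close>
  have "\<forall>i\<in>{J..<L}. best_approx (N 0) (N L) ((B(J := sprod xs)) i) ((B(J := sprod xs)) (Suc i)) (cut (\<sigma> i))"
    using B step(3) by auto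
  then show ?case using B(2) hyps(1) by (intro exI[of _ "B(J := sprod xs)"]) auto
qed

text \<open>The state with all intervals of length one. It makes the product lemmas for states
  available for arbitrary lists of \<open>\<beta>\<close>-factors.\<close>

definition layers :: "(nat \<Rightarrow> cmat) \<Rightarrow> nat \<Rightarrow> nat \<Rightarrow> bstate" where
  "layers Xs p q = map (\<lambda>l. ((l, l), Xs l)) [p..<Suc q]"

lemma tiles_layers: "p \<le> Suc q \<Longrightarrow> tiles p q (map fst (layers Xs p q))"
proof (induction "Suc q - p" arbitrary: p)
  case 0
  then show ?case by (simp add: layers_def)
next
  case (Suc n)
  then have "layers Xs p q = ((p, p), Xs p) # layers Xs (Suc p) q"
    by (simp add: layers_def upt_conv_Cons del: upt_Suc)
  then show ?case using Suc by simp
qed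

lemma sprod_layers:
  assumes "1 \<le> k"
  shows "sprod (layers Xs 1 k) = prodk \<beta> Xs k"
  using assms
proof (induction k rule: dec_induct)
  case base
  then show ?case by (simp add: layers_def sprod_Cons)
next
  case (step k)
  have "layers Xs 1 (Suc k) = layers Xs 1 k @ [((Suc k, Suc k), Xs (Suc k))]" by (simp add: layers_def)
  moreover have "layers Xs 1 k \<noteq> []" using step.hyps by (simp add: layers_def)
  ultimately have "sprod (layers Xs 1 (Suc k)) = mmul (N k) (prodk \<beta> Xs k) (Xs (Suc k))"
    using step.IH by (simp add: sprod_append)
  then show ?case using step.hyps by (cases k) (auto simp: N_def)
qed

lemma prodk_in_cut:
  assumes Ys: "Ys \<in> factors \<beta> L" and s: "s \<in> {1..<L}"
  shows "prodk \<beta> Ys L \<in> cut s"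
proof -
  have f: "factored (layers Ys p q)" if "1 \<le> p" "q \<le> L" for p q
    using Ys that by (auto simp: factored_def layers_def factors_def patI_same)
  have "[1..<Suc L] = [1..<Suc s] @ [Suc s..<Suc L]" 
    using upt_add_eq_append[of 1 "Suc s" "L - s"] s by (simp del: upt_Suc)
  then have "layers Ys 1 L = layers Ys 1 s @ layers Ys (Suc s) L" by (simp add: layers_def del: upt_Suc)
  moreover have ne: "layers Ys 1 s \<noteq> []" "layers Ys (Suc s) L \<noteq> []" using s by (auto simp: layers_def)
  moreover have "fst (fst (hd (layers Ys (Suc s) L))) = Suc s"
    using s by (simp add: layers_def upt_conv_Cons del: upt_Suc)
  ultimately have "prodk \<beta> Ys L = mmul (N s) (sprod (layers Ys 1 s)) (sprod (layers Ys (Suc s) L))"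
    using sprod_layers[of L Ys] L_pos by (simp add: sprod_append rmul_sprod)
  moreover have "supported (sp 1 s) (sprod (layers Ys 1 s))"
    using s ne f by (intro sprod_supported tiles_layers) auto
  moreover have "supported (sp (Suc s) L) (sprod (layers Ys (Suc s) L))"
    using s ne f by (intro sprod_supported tiles_layers) auto
  ultimately show ?thesis by (simp add: cutsetI)
qed

lemma butterfly_nonred_error:
  assumes bf: "butterfly_nonred \<beta> L \<sigma> A Xs" and bij: "bij_betw \<sigma> {1..<L} {1..<L}"
    and Ys: "Ys \<in> factors \<beta> L"
  defines "err \<equiv> \<lambda>Xs. fnorm (prow (\<beta> 1)) (pcol (\<beta> L)) (\<lambda>i j. A i j - prodk \<beta> Xs L i j)"
  shows "err Xs \<le> (real (max L 2) - 1) * err Ys"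
    and "\<forall>J\<in>{1..<L}. \<sigma> J = J \<Longrightarrow> err Xs \<le> sqrt (real (max L 2) - 1) * err Ys"
proof -
  have "err Xs \<le> (real (max L 2) - 1) * err Ys \<and>
    ((\<forall>J\<in>{1..<L}. \<sigma> J = J) \<longrightarrow> err Xs \<le> sqrt (real (max L 2) - 1) * err Ys)"
  proof (cases "L = 1")
    case True
    \<comment> \<open>At depth one, masking is optimal entry by entry: no error on the support, and
      the unavoidable one off it.\<close>
    have "(cmod (A i j - Xs 1 i j))\<^sup>2 \<le> (cmod (A i j - Ys 1 i j))\<^sup>2" for i j
    proof (cases "supp (\<beta> 1) i j")
      case False
      then have "Ys 1 i j = 0" using Ys True by (auto simp: factors_def is_factor_def)
      then show ?thesis using bf True False by (simp add: butterfly_nonred_def Smat_def)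
    qed (use bf True in \<open>simp add: butterfly_nonred_def Smat_def\<close>)
    then have "err Xs \<le> err Ys"
      unfolding err_def fnorm_def using True by (auto intro!: sum_mono)
    then show ?thesis using True by simp
  next
    case False
    then obtain ys where it: "bf_iter \<beta> \<sigma> L 1 [((1, L), A)] ys" and len: "length ys = L"
      and ys: "\<forall>l\<in>{1..L}. ys ! (l - 1) = ((l, l), Xs l)"
      using bf by (auto simp: butterfly_nonred_def)
    have "ys = layers Xs 1 L"
    proof (rule nth_equalityI)
      show "length ys = length (layers Xs 1 L)" using len by (simp add: layers_def)
      fix i assume "i < length ys"
      then show "ys ! i = layers Xs 1 L ! i"
        using bspec[OF ys, of "Suc i"] len by (simp add: layers_def del: upt_Suc)
    qed
    then have zs: "sprod ys = prodk \<beta> Xs L" using sprod_layers L_pos by simp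
    have \<sigma>: "inj_on \<sigma> {1..<L}" "\<sigma> ` {1..<L} \<subseteq> {1..<L}" using bij by (auto simp: bij_betw_def)
    obtain B where B: "B 1 = A" "B L = prodk \<beta> Xs L"
      "\<And>i. i \<in> {1..<L} \<Longrightarrow> best_approx (N 0) (N L) (B i) (B (Suc i)) (cut (\<sigma> i))"
      using bf_iter_best_approx[OF it \<sigma>] L_pos zs by (auto simp: sprod_Cons)
    have e: "err Zs = fnorm (N 0) (N L) (\<lambda>i j. A i j - prodk \<beta> Zs L i j)" for Zs
      using L_pos by (simp add: err_def N_def)
    have "err Xs \<le> (real L - 1) * err Ys"
      using total_error_le[OF \<sigma>(2) B(3) prodk_in_cut[OF Ys] L_pos] unfolding B(1,2) e .
    moreover have "err Xs \<le> sqrt (real L - 1) * err Ys" if "\<forall>J\<in>{1..<L}. \<sigma> J = J"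
    proof -
      have "best_approx (N 0) (N L) (B i) (B (Suc i)) (cut i)" if "i \<in> {1..<L}" for i
        using B(3)[OF that] \<open>\<forall>J\<in>{1..<L}. \<sigma> J = J\<close> that by simp
      from total_error_le_sqrt[OF this prodk_in_cut[OF Ys] L_pos] show ?thesis unfolding B(1,2) e .
    qed
    moreover have "max L 2 = L" using False L_pos by simp
    ultimately show ?thesis by simp
  qed
  then show "err Xs \<le> (real (max L 2) - 1) * err Ys"
    and "\<forall>J\<in>{1..<L}. \<sigma> J = J \<Longrightarrow> err Xs \<le> sqrt (real (max L 2) - 1) * err Ys" by blast+
qed

end

section \<open>Merging redundant pairs\<close>

lemma prodk_Suc: "1 \<le> k \<Longrightarrow> prodk \<beta> Xs (Suc k) = mmul (pcol (\<beta> k)) (prodk \<beta> Xs k) (Xs (Suc k))"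
  by (cases k) auto

lemma pstar_props:
  assumes v: "valid_pattern \<pi>1" "valid_pattern \<pi>2" and c: "chainable \<pi>1 \<pi>2"
  shows "valid_pattern (pstar \<pi>1 \<pi>2)" "prow (pstar \<pi>1 \<pi>2) = prow \<pi>1" "pcol (pstar \<pi>1 \<pi>2) = pcol \<pi>2"
    "pa (pstar \<pi>1 \<pi>2) * pc (pstar \<pi>1 \<pi>2) = pa \<pi>2 * pc \<pi>2"
proof -
  have dv: "pa \<pi>1 dvd pa \<pi>2" "pd \<pi>2 dvd pd \<pi>1" using c by (auto simp: chainable_def)
  then show ac: "pa (pstar \<pi>1 \<pi>2) * pc (pstar \<pi>1 \<pi>2) = pa \<pi>2 * pc \<pi>2" by simp
  then show "pcol (pstar \<pi>1 \<pi>2) = pcol \<pi>2" unfolding pcol_def by simp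
  have bd: "pb (pstar \<pi>1 \<pi>2) * pd \<pi>2 = pb \<pi>1 * pd \<pi>1" using dv by simp
  then show "prow (pstar \<pi>1 \<pi>2) = prow \<pi>1" unfolding prow_def mult.assoc by simp
  have "0 < pa (pstar \<pi>1 \<pi>2) * pc (pstar \<pi>1 \<pi>2)" "0 < pb (pstar \<pi>1 \<pi>2) * pd \<pi>2"
    unfolding ac bd using v by (simp_all add: valid_pattern_def)
  then show "valid_pattern (pstar \<pi>1 \<pi>2)"
    using v unfolding valid_pattern_def by (metis nat_0_less_mult_iff pstar_sel(1,4))
qed

text \<open>Multiplying the two merged factors shows that every product for \<open>\<beta>\<close>
  is also one for \<open>\<beta>'\<close>. Chainability with the neighbours survives because outer
  sizes are kept and the required divisibilities pass across the merged pair by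
  transitivity.\<close>

lemma merge_step_props:
  assumes ar: "is_arch \<beta> L" and ch: "chainable_arch \<beta> L" and ms: "merge_step (\<beta>, L) (\<beta>', L')"
  shows "is_arch \<beta>' L'" "chainable_arch \<beta>' L'" "L' \<le> L"
    "prow (\<beta>' 1) = prow (\<beta> 1)" "pcol (\<beta>' L') = pcol (\<beta> L)"
    "Ys \<in> factors \<beta> L \<Longrightarrow> \<exists>Ys'\<in>factors \<beta>' L'. prodk \<beta>' Ys' L' = prodk \<beta> Ys L"
proof -
  interpret architecture \<beta> L using ar ch by unfold_locales
  obtain l where l: "1 \<le> l" "l < L" and L': "L' = L - 1"
    and \<beta>': "\<beta>' = (\<lambda>k. if k < l then \<beta> k else if k = l then pstar (\<beta> l) (\<beta> (Suc l)) else \<beta> (Suc k))"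
    using ms unfolding merge_step_def fst_conv snd_conv by blast
  have v: "valid_pattern (\<beta> k)" if "1 \<le> k" "k \<le> L" for k using ar that by (simp add: is_arch_def)
  have c: "chainable (\<beta> k) (\<beta> (Suc k))" if "1 \<le> k" "k < L" for k using ch that by (simp add: chainable_arch_def)
  have vl: "valid_pattern (\<beta> l)" and vl': "valid_pattern (\<beta> (Suc l))" using v l by simp_all
  note st = pstar_props[OF vl vl' c[OF l]]
  have v': "valid_pattern (\<beta>' k)" if "1 \<le> k" "k \<le> L'" for k
    using v st that l L' by (auto simp: \<beta>')
  have c': "chainable (\<beta>' k) (\<beta>' (Suc k))" if k: "1 \<le> k" "k < L'" for k
  proof -
    consider "Suc k < l" | "Suc k = l" | "k = l" | "l < k" by linarith
    then show ?thesis
    proof cases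
      case 2
      have ck: "chainable (\<beta> k) (\<beta> l)" using c[of k] k L' l 2 by simp
      have vk: "valid_pattern (\<beta> k)" using v[of k] k L' by simp
      have "pd (\<beta> (Suc l)) dvd pd (\<beta> k)" using d_dvd[of k "Suc l"] l 2 k by simp
      then have "chainable (\<beta> k) (pstar (\<beta> l) (\<beta> (Suc l)))"
        using ck unfolding chainable_size[OF vk vl] chainable_size[OF vk st(1)] st(2) pstar_sel by blast
      moreover have "\<beta>' k = \<beta> k" "\<beta>' (Suc k) = pstar (\<beta> l) (\<beta> (Suc l))" using 2 by (simp_all add: \<beta>')
      ultimately show ?thesis by simp
    next
      case 3
      have cl: "chainable (\<beta> (Suc l)) (\<beta> (Suc (Suc l)))" using c[of "Suc l"] k L' 3 by simp
      have vl'': "valid_pattern (\<beta> (Suc (Suc l)))" using v[of "Suc (Suc l)"] k L' 3 by simp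
      have "pa (\<beta> l) dvd pa (\<beta> (Suc (Suc l)))" using a_dvd[of l "Suc (Suc l)"] l 3 k L' by simp
      then have "chainable (pstar (\<beta> l) (\<beta> (Suc l))) (\<beta> (Suc (Suc l)))"
        using cl unfolding chainable_size[OF vl' vl''] chainable_size[OF st(1) vl''] st(3,4)
        unfolding pstar_sel(1,4) by blast
      moreover have "\<beta>' k = pstar (\<beta> l) (\<beta> (Suc l))" "\<beta>' (Suc k) = \<beta> (Suc (Suc l))" using 3 by (simp_all add: \<beta>')
      ultimately show ?thesis by simp
    qed (use c k L' in \<open>auto simp: \<beta>'\<close>)
  qed
  show "chainable_arch \<beta>' L'" using c' by (simp add: chainable_arch_def)
  show "is_arch \<beta>' L'"
    unfolding is_arch_def
  proof (intro conjI ballI)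
    show "1 \<le> L'" using l L' by simp
    fix k assume "k \<in> {1..<L'}"
    then show "pa (\<beta>' k) * pc (\<beta>' k) * pd (\<beta>' k) = pa (\<beta>' (Suc k)) * pb (\<beta>' (Suc k)) * pd (\<beta>' (Suc k))"
      using c'[of k] v'[of k] v'[of "Suc k"] by (simp add: chainable_size pcol_def prow_def)
  qed (use v' in simp)
  show "L' \<le> L" by (simp add: L')
  show "prow (\<beta>' 1) = prow (\<beta> 1)" using st l by (auto simp: \<beta>')
  show "pcol (\<beta>' L') = pcol (\<beta> L)" using st l L' by (auto simp: \<beta>')
  assume Ys: "Ys \<in> factors \<beta> L"
  define Ys' where "Ys' = (\<lambda>k. if k < l then Ys k else if k = l then mmul (pcol (\<beta> l)) (Ys l) (Ys (Suc l)) else Ys (Suc k))"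
  have "is_factor (pstar (\<beta> l) (\<beta> (Suc l))) (mmul (pcol (\<beta> l)) (Ys l) (Ys (Suc l)))"
  proof -
    have "patI \<beta> l (Suc l) = pstar (\<beta> l) (\<beta> (Suc l))" by (simp add: patI_def)
    moreover have "supported (sp l l) (Ys l)" "supported (sp (Suc l) (Suc l)) (Ys (Suc l))"
      using Ys l by (auto simp: factors_def patI_same is_factor_eq_supported)
    ultimately show ?thesis
      using supported_mmul[of l l "Ys l" "Suc l" "Ys (Suc l)"] l by (simp add: is_factor_eq_supported)
  qed
  then have "Ys' \<in> factors \<beta>' L'" using Ys l L' by (auto simp: factors_def Ys'_def \<beta>')
  moreover have "prodk \<beta>' Ys' L' = prodk \<beta> Ys L"
  proof -
    have low: "k < l \<Longrightarrow> prodk \<beta>' Ys' k = prodk \<beta> Ys k" for k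
    proof (induction k)
      case (Suc k)
      then show ?case by (cases "k = 0") (auto simp: prodk_Suc \<beta>' Ys'_def)
    qed simp
    \<comment> \<open>From position \<open>l\<close> on the merged index lags by one; associativity
      absorbs the merged factor at \<open>k = l\<close>.\<close>
    have "prodk \<beta>' Ys' k = prodk \<beta> Ys (Suc k)" if "l \<le> k" for k
      using that
    proof (induction k rule: dec_induct)
      case base
      show ?case
      proof (cases "l = 1")
        case True
        then show ?thesis by (simp add: Ys'_def)
      next
        case False
        then obtain e where e: "l = Suc e" "1 \<le> e" using l by (cases l) auto
        then have "prodk \<beta>' Ys' l = mmul (pcol (\<beta> e)) (prodk \<beta> Ys e) (mmul (pcol (\<beta> l)) (Ys l) (Ys (Suc l)))"
          using low[of e] by (simp add: prodk_Suc \<beta>' Ys'_def)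
        then show ?thesis using e l by (simp add: prodk_Suc mmul_assoc)
      qed
    next
      case (step k)
      have "pcol (\<beta>' k) = pcol (\<beta> (Suc k))" using st step l by (auto simp: \<beta>')
      then show ?case using step l by (simp add: prodk_Suc) (simp add: Ys'_def)
    qed
    from this[of L'] show ?thesis using l L' by simp
  qed
  ultimately show "\<exists>Ys'\<in>factors \<beta>' L'. prodk \<beta>' Ys' L' = prodk \<beta> Ys L" by blast
qed

lemma merge_steps_props:
  assumes "merge_step\<^sup>*\<^sup>* (\<beta>, L) (\<beta>', L')" "is_arch \<beta> L" "chainable_arch \<beta> L"
  shows "is_arch \<beta>' L' \<and> chainable_arch \<beta>' L' \<and> L' \<le> L \<and>
    prow (\<beta>' 1) = prow (\<beta> 1) \<and> pcol (\<beta>' L') = pcol (\<beta> L) \<and>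
    (\<forall>Ys\<in>factors \<beta> L. \<exists>Ys'\<in>factors \<beta>' L'. prodk \<beta>' Ys' L' = prodk \<beta> Ys L)"
  using assms(1)
proof (induction rule: rtranclp_induct2)
  case refl
  then show ?case using assms(2,3) by auto
next
  case (step \<beta>1 L1 \<beta>2 L2)
  note m = merge_step_props[of \<beta>1 L1 \<beta>2 L2]
  have "\<exists>Ys'\<in>factors \<beta>2 L2. prodk \<beta>2 Ys' L2 = prodk \<beta> Ys L" if "Ys \<in> factors \<beta> L" for Ys
  proof -
    have "\<exists>Zs\<in>factors \<beta>1 L1. prodk \<beta>1 Zs L1 = prodk \<beta> Ys L" using step.IH that by simp
    then obtain Zs where "Zs \<in> factors \<beta>1 L1" "prodk \<beta>1 Zs L1 = prodk \<beta> Ys L" ..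
    then show ?thesis using m(6)[of Zs] step.IH step.hyps(2) by simp
  qed
  then show ?case using m(1-5) step.IH step.hyps(2) by simp
qed

theorem theorem7p4:
  fixes \<beta> :: "nat \<Rightarrow> pattern" and L :: nat and A :: cmat
    and \<sigma> :: "nat \<Rightarrow> nat" and Xs :: "nat \<Rightarrow> cmat"
  assumes "is_arch \<beta> L"
    and "chainable_arch \<beta> L"
    and "bij_betw \<sigma> {1..<L} {1..<L}"
    and "butterfly \<beta> L \<sigma> A Xs"
  shows "fnorm (prow (\<beta> 1)) (pcol (\<beta> L)) (\<lambda>i j. A i j - prodk \<beta> Xs L i j)
           \<le> (real (max L 2) - 1) * Ebeta \<beta> L A
       \<and> ((\<forall>J\<in>{1..<L}. \<sigma> J = J) \<longrightarrow>
          fnorm (prow (\<beta> 1)) (pcol (\<beta> L)) (\<lambda>i j. A i j - prodk \<beta> Xs L i j)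
           \<le> sqrt (real (max L 2) - 1) * Ebeta \<beta> L A)"
proof -
  define err where "err = (\<lambda>Xs. fnorm (prow (\<beta> 1)) (pcol (\<beta> L)) (\<lambda>i j. A i j - prodk \<beta> Xs L i j))"
  have err_nonneg: "0 \<le> err Ys" for Ys by (simp add: err_def fnorm_nonneg)
  \<comment> \<open>Competitors are treated one at a time, so no minimiser for \<open>Ebeta\<close>
    has to exist.\<close>
  have bound: "err Xs \<le> (real (max L 2) - 1) * err Ys \<and>
      ((\<forall>J\<in>{1..<L}. \<sigma> J = J) \<longrightarrow> err Xs \<le> sqrt (real (max L 2) - 1) * err Ys)"
    if Ys: "Ys \<in> factors \<beta> L" for Ys
  proof (cases "redundant_arch \<beta> L")
    case False
    interpret architecture \<beta> L using assms by unfold_locales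
    show ?thesis
      using butterfly_nonred_error[OF _ assms(3) Ys] assms(4) False by (simp add: butterfly_def err_def)
  next
    case True
    then have nn: "\<not> \<not> redundant_arch \<beta> L" by simp
    obtain \<beta>' L' \<sigma>' Zs where ms: "merge_step\<^sup>*\<^sup>* (\<beta>, L) (\<beta>', L')"
      and bij: "bij_betw \<sigma>' {1..<L'} {1..<L'}"
      and id: "(\<forall>J\<in>{1..<L}. \<sigma> J = J) \<longrightarrow> (\<forall>J\<in>{1..<L'}. \<sigma>' J = J)"
      and bf: "butterfly_nonred \<beta>' L' \<sigma>' A Zs" and Zs: "prodk \<beta> Xs L = prodk \<beta>' Zs L'"
      using assms(4)[unfolded butterfly_def if_not_P[OF nn]] by (elim exE conjE)
    note m = merge_steps_props[OF ms assms(1,2)]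
    interpret architecture \<beta>' L' using m by unfold_locales auto
    obtain Ys' where Ys': "Ys' \<in> factors \<beta>' L'" "prodk \<beta>' Ys' L' = prodk \<beta> Ys L" using m Ys by blast
    note b = butterfly_nonred_error[OF bf bij Ys'(1)]
    have "err Xs \<le> (real (max L' 2) - 1) * err Ys"
      using b(1) m by (simp add: err_def Ys'(2) Zs)
    \<comment> \<open>Merging only shortens the architecture, so the constant for \<open>L'\<close>
      is at most the one for \<open>L\<close>.\<close>
    also have "\<dots> \<le> (real (max L 2) - 1) * err Ys"
      using m by (intro mult_right_mono err_nonneg) auto
    finally have "err Xs \<le> (real (max L 2) - 1) * err Ys" .
    moreover have "err Xs \<le> sqrt (real (max L 2) - 1) * err Ys" if "\<forall>J\<in>{1..<L}. \<sigma> J = J"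
    proof -
      have "err Xs \<le> sqrt (real (max L' 2) - 1) * err Ys"
        using b(2) m id that by (simp add: err_def Ys'(2) Zs)
      also have "\<dots> \<le> sqrt (real (max L 2) - 1) * err Ys"
        using m by (intro mult_right_mono err_nonneg) auto
      finally show ?thesis .
    qed
    ultimately show ?thesis by blast
  qed
  have "(\<lambda>_ _ _. 0) \<in> factors \<beta> L" by (simp add: factors_def is_factor_def)
  then have ne: "{err Xs | Xs. Xs \<in> factors \<beta> L} \<noteq> {}" by blast
  \<comment> \<open>A positive constant can be divided out before passing to the infimum; the zero
    factors show that the set is nonempty. Both constants are at least 1 because of the
    \<open>max\<close> with 2.\<close>
  have le_inf: "err Xs \<le> c * Ebeta \<beta> L A" if "c \<ge> 1" and "\<And>Ys. Ys \<in> factors \<beta> L \<Longrightarrow> err Xs \<le> c * err Ys" for c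
  proof -
    have "err Xs / c \<le> Inf {err Xs | Xs. Xs \<in> factors \<beta> L}"
      using that by (intro cInf_greatest[OF ne]) (auto simp: field_simps)
    then show ?thesis using that(1) by (simp add: Ebeta_def err_def field_simps)
  qed
  have "err Xs \<le> (real (max L 2) - 1) * Ebeta \<beta> L A"
    by (rule le_inf) (use bound in auto)
  moreover have "err Xs \<le> sqrt (real (max L 2) - 1) * Ebeta \<beta> L A" if "\<forall>J\<in>{1..<L}. \<sigma> J = J"
    by (rule le_inf) (use bound that in auto)
  ultimately show ?thesis unfolding err_def by blast
qed

end
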